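(* Let $n\ge 1$ and let $V\in C^2(\mathbb{T}^n)$ satisfy $V\ge 0$ on $\mathbb{T}^n$, $\{V=0\}=\{x_1,\ldots,x_m\}$ (a finite nonempty set of distinct points), and $D^2V(x_i)$ positive definite for every $1\le i\le m$. Fix $\alpha>0$. Assume that there exists a unique $j\in\{1,\ldots,m\}$ such that $$0<\kappa_j<\kappa_i\qquad\text{for all }i\in\{1,\ldots,m\}\setminus\{j\}.$$ For $\varepsilon\in(0,1)$ let $w^\varepsilon$ be the solution of $$\varepsilon^\alpha w^\varepsilon-\varepsilon\Delta w^\varepsilon+|Dw^\varepsilon|^2=V\qquad\text{in }\mathbb{T}^n,$$ and define $$\rho^\varepsilon(x):=\frac{e^{-w^\varepsilon(x)/\varepsilon}}{\displaystyle\int_{\mathbb{T}^n}e^{-w^\varepsilon(y)/\varepsilon}\,dy}.$$ Then, in the sense of (weak convergence of) measures as $\varepsilon\to 0$, $$\rho^\varepsilon(x)\,dx\rightharpoonup\delta_{x_j}.$$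
   Context: $\mathbb{T}^n=\mathbb{R}^n/\mathbb{Z}^n$ is the flat torus. The equation for $w^\varepsilon$ has, for each $\varepsilon>0$, a unique viscosity solution, which is classical. For $1\le i\le m$ set $A_i:=\left(\tfrac12 D^2V(x_i)\right)^{1/2}$ (the positive definite symmetric square root) and $\kappa_i:=\operatorname{tr}A_i$. $\delta_{x_j}$ is the Dirac measure at $x_j$. *)

theory Defs
  imports "HOL-Probability.Probability"
begin

text \<open>
  The flat torus is the quotient of \<open>real ^ 'n\<close> by the lattice of integer vectors.
  Functions on the torus are functions on \<open>real ^ 'n\<close> that are invariant under this lattice
  (so continuity and derivatives are those of the lift), and points of the torus are the points
  of the half-open unit cube, which contains exactly one representative of every class.
\<close>

definition periodic :: "(real ^ 'n \<Rightarrow> 'b) \<Rightarrow> bool" where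
  "periodic f \<longleftrightarrow> (\<forall>x k. (\<forall>i. k $ i \<in> \<int>) \<longrightarrow> f (x + k) = f x)"

definition torus_points :: "(real ^ 'n) set" where
  "torus_points = {x. \<forall>i. 0 \<le> x $ i \<and> x $ i < 1}"

definition torus_measure :: "(real ^ 'n) measure" where
  "torus_measure = restrict_space lborel torus_points"

definition partial_deriv :: "'n \<Rightarrow> (real ^ 'n \<Rightarrow> real) \<Rightarrow> real ^ 'n \<Rightarrow> real" where
  "partial_deriv i f x = frechet_derivative f (at x) (axis i 1)"

definition gradient :: "(real ^ 'n \<Rightarrow> real) \<Rightarrow> real ^ 'n \<Rightarrow> real ^ 'n" where
  "gradient f x = (\<chi> i. partial_deriv i f x)"

definition hessian :: "(real ^ 'n \<Rightarrow> real) \<Rightarrow> real ^ 'n \<Rightarrow> real ^ 'n ^ 'n" where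
  "hessian f x = (\<chi> i j. partial_deriv i (partial_deriv j f) x)"

definition laplacian :: "(real ^ 'n \<Rightarrow> real) \<Rightarrow> real ^ 'n \<Rightarrow> real" where
  "laplacian f x = (\<Sum>i\<in>UNIV. partial_deriv i (partial_deriv i f) x)"

text \<open>
  Differentiability of \<open>f\<close> and of its first partial derivatives is required explicitly because
  \<^const>\<open>frechet_derivative\<close> has an unspecified value where no derivative exists.
\<close>

definition C2 :: "(real ^ 'n \<Rightarrow> real) \<Rightarrow> bool" where
  "C2 f \<longleftrightarrow>
     (\<forall>x. f differentiable (at x)) \<and>
     (\<forall>i x. partial_deriv i f differentiable (at x)) \<and>
     (\<forall>i j. continuous_on UNIV (partial_deriv i (partial_deriv j f)))"

definition C2_torus :: "(real ^ 'n \<Rightarrow> real) \<Rightarrow> bool" where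
  "C2_torus f \<longleftrightarrow> periodic f \<and> C2 f"

definition pos_def :: "real ^ 'n ^ 'n \<Rightarrow> bool" where
  "pos_def M \<longleftrightarrow> transpose M = M \<and> (\<forall>v. v \<noteq> 0 \<longrightarrow> 0 < v \<bullet> (M *v v))"

text \<open>Meaningful for positive definite \<open>M\<close>, for which exactly one such root exists.\<close>

definition matrix_sqrt :: "real ^ 'n ^ 'n \<Rightarrow> real ^ 'n ^ 'n" where
  "matrix_sqrt M = (THE A. pos_def A \<and> A ** A = M)"

definition kappa :: "(real ^ 'n \<Rightarrow> real) \<Rightarrow> real ^ 'n \<Rightarrow> real" where
  "kappa V x = trace (matrix_sqrt ((1/2) *\<^sub>R hessian V x))"

definition classical_solution ::
    "real \<Rightarrow> real \<Rightarrow> (real ^ 'n \<Rightarrow> real) \<Rightarrow> (real ^ 'n \<Rightarrow> real) \<Rightarrow> bool" where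
  "classical_solution \<alpha> \<epsilon> V w \<longleftrightarrow>
     C2_torus w \<and>
     (\<forall>x. (\<epsilon> powr \<alpha>) * w x - \<epsilon> * laplacian w x + (norm (gradient w x))\<^sup>2 = V x)"

definition gibbs_density :: "real \<Rightarrow> (real ^ 'n \<Rightarrow> real) \<Rightarrow> real ^ 'n \<Rightarrow> real" where
  "gibbs_density \<epsilon> w x =
     exp (- w x / \<epsilon>) / (LINT y|torus_measure. exp (- w y / \<epsilon>))"

text \<open>
  Weak convergence of measures on the torus.  The test functions are continuous on the torus,
  i.e. continuous and periodic on \<open>real ^ 'n\<close>; functions that are merely continuous on the
  half-open cube would not be admissible.  They are bounded, the torus being compact.
\<close>

definition torus_weak_convergence ::
    "(real \<Rightarrow> (real ^ 'n) measure) \<Rightarrow> (real ^ 'n) measure \<Rightarrow> real filter \<Rightarrow> bool" where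
  "torus_weak_convergence \<mu> \<nu> F \<longleftrightarrow>
     (\<forall>\<phi> :: real ^ 'n \<Rightarrow> real. continuous_on UNIV \<phi> \<and> periodic \<phi> \<longrightarrow>
        ((\<lambda>\<epsilon>. LINT x|\<mu> \<epsilon>. \<phi> x) \<longlongrightarrow> (LINT x|\<nu>. \<phi> x)) F)"

end

theory Submission
  imports Defs "HOL-Real_Asymp.Real_Asymp"
begin

text \<open>
  The function \<open>u = exp (- w / \<epsilon>)\<close> turns the equation for \<open>w\<close> into the Schroedinger equation
  \<open>\<epsilon>\<^sup>2 \<Delta>u = (V - \<epsilon>\<^sup>\<alpha> w) u\<close>, in which the unknown \<open>\<epsilon>\<^sup>\<alpha> w\<close> plays the role of an energy.  Let \<open>c\<close> be the
  minimum of \<open>w\<close>, so that \<open>exp (- c / \<epsilon>)\<close> is the maximum of \<open>u\<close>.  Every estimate is relative to this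
  maximum.  The energy \<open>\<epsilon>\<^sup>\<alpha> c\<close> is controlled only up to \<open>o(\<epsilon>)\<close>, and such an error may be huge in \<open>c\<close>
  itself, but it cancels in the quotient that defines the Gibbs density.

  Near a zero \<open>z\<close> of \<open>V\<close> the potential is \<open>\<bar>A (x - z)\<bar>\<^sup>2\<close> up to a factor close to 1, where \<open>A\<close> is the
  root of half of the Hessian.  The Gaussian \<open>exp (- y \<bullet> A y / (2 \<epsilon>))\<close> is the ground state of
  \<open>- \<epsilon>\<^sup>2 \<Delta> + \<bar>A y\<bar>\<^sup>2\<close>, with energy \<open>\<epsilon> tr A\<close>; slightly narrowed or widened Gaussians absorb the error in
  the potential.  Comparison with them gives two facts.  A positive solution cannot have energy
  everywhere above the ground energy of a well, hence \<open>\<epsilon>\<^sup>\<alpha> c \<le> \<epsilon> k\<close> for every \<open>k\<close> above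
  the least \<open>\<kappa>\<close> (\<open>energy_upper_bound\<close>).  Conversely, in a well whose ground energy lies above the
  available energy, \<open>u\<close> cannot come near its maximum (\<open>high_energy_well_bound\<close>).  Where \<open>V > 0\<close> it
  cannot either, as the energy tends to 0 (\<open>positive_potential_bound\<close>).  In both cases \<open>u\<close> is smaller
  than its maximum by a factor \<open>exp (- h / \<epsilon>)\<close>, up to a constant, with \<open>h = \<epsilon>\<^sup>\<beta>\<close>.  The exponent \<open>\<beta>\<close> satisfies
  two conditions that are compatible for every \<open>\<alpha> > 0\<close>: \<open>\<beta> < 1\<close> makes \<open>exp (- h / \<epsilon>)\<close> smaller than
  every power of \<open>\<epsilon>\<close>, and \<open>\<alpha> + \<beta> > 1\<close> makes the energy \<open>\<epsilon>\<^sup>\<alpha> h\<close> of a rise of \<open>w\<close> by \<open>h\<close> negligible against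
  the gaps of size \<open>\<epsilon>\<close> between the wells.

  It remains to see that the partition function is at least a power of \<open>\<epsilon>\<close> times the maximum of \<open>u\<close>.
  Comparing \<open>w\<close> with its translates shows that \<open>w\<close> has Lipschitz constant \<open>O(\<epsilon>\<^sup>-\<^sup>\<alpha>)\<close>, so \<open>u\<close> is comparable to
  its maximum on a cube with side of order \<open>\<epsilon>\<close> to the power \<open>1 + \<alpha>\<close> (\<open>partition_function_lower_bound\<close>).  Hence
  the Gibbs density tends to 0 uniformly outside every neighbourhood of the well with the least \<open>\<kappa>\<close>.
\<close>

section \<open>Square roots of positive definite matrices\<close>

lemma bounded_below_pos_def:
  fixes A :: "real ^ 'n ^ 'n"
  assumes "pos_def A"
  obtains \<mu> where "\<mu> > 0" "\<And>v. \<mu> * (norm v)\<^sup>2 \<le> v \<bullet> (A *v v)" "\<And>v. \<mu> * norm v \<le> norm (A *v v)"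
proof -
  have "compact (sphere (0::real^'n) 1)" "sphere (0::real^'n) 1 \<noteq> {}" by auto
  moreover have "continuous_on (sphere 0 1) (\<lambda>v. v \<bullet> (A *v v))"
    by (intro continuous_intros linear_continuous_on matrix_vector_mul_bounded_linear)
  ultimately obtain e where e: "e \<in> sphere 0 1" "\<And>v. v \<in> sphere 0 1 \<Longrightarrow> e \<bullet> (A *v e) \<le> v \<bullet> (A *v v)"
    using continuous_attains_inf[of "sphere (0::real^'n) 1" "\<lambda>v. v \<bullet> (A *v v)"] by metis
  define \<mu> where "\<mu> = e \<bullet> (A *v e)"
  have "e \<noteq> 0" using e(1) by auto
  then have mu: "\<mu> > 0" using assms unfolding pos_def_def \<mu>_def by blast
  have b: "\<mu> * (norm v)\<^sup>2 \<le> v \<bullet> (A *v v)" for v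
  proof (cases "v = 0")
    case False
    then have "\<mu> \<le> (v /\<^sub>R norm v) \<bullet> (A *v (v /\<^sub>R norm v))"
      unfolding \<mu>_def by (intro e(2)) auto
    also have "\<dots> = (v \<bullet> (A *v v)) / (norm v)\<^sup>2"
      by (simp add: matrix_vector_mult_scaleR power2_eq_square field_simps)
    finally show ?thesis using False by (simp add: field_simps)
  qed simp
  have "\<mu> * norm v \<le> norm (A *v v)" for v
  proof (cases "v = 0")
    case False
    have "\<mu> * (norm v)\<^sup>2 \<le> norm v * norm (A *v v)"
      using b[of v] norm_cauchy_schwarz[of v "A *v v"] by linarith
    then show ?thesis using False by (simp add: power2_eq_square)
  qed simp
  with mu b that show ?thesis by blast
qed

lemma inner_symmetric_matrix:
  fixes A :: "real ^ 'n ^ 'n"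
  assumes "transpose A = A"
  shows "u \<bullet> (A *v v) = (A *v u) \<bullet> v"
  using assms by (metis dot_lmul_matrix vector_transpose_matrix)

text \<open>
  A root of \<open>M\<close> with \<open>M\<close> close to the identity is sought in the form \<open>1 - Y\<close>: the equation
  \<open>(1 - Y)\<^sup>2 = M\<close> reads \<open>Y = (C + Y\<^sup>2) / 2\<close> with \<open>C = 1 - M\<close>.  If \<open>C\<close> has norm at most \<open>q < 1\<close>, the right-hand side
  is a contraction of the complete set of symmetric operators of norm at most \<open>q\<close>, and \<open>1 - Y\<close> is
  positive definite because \<open>q < 1\<close>.  A general \<open>M\<close> is first multiplied by a small \<open>t > 0\<close>.
\<close>

lemma pos_def_sqrt_exists:
  fixes M :: "real ^ 'n ^ 'n"
  assumes M: "pos_def M"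
  shows "\<exists>A. pos_def A \<and> A ** A = M"
proof -
  obtain \<mu> where mu: "\<mu> > 0" and below: "\<And>v. \<mu> * (norm v)\<^sup>2 \<le> v \<bullet> (M *v v)"
    and below': "\<And>v. \<mu> * norm v \<le> norm (M *v v)"
    using bounded_below_pos_def[OF M] by metis
  obtain L where L: "L > 0" "\<And>v. norm (M *v v) \<le> norm v * L"
    using bounded_linear.pos_bounded[OF matrix_vector_mul_bounded_linear[of M]] by blast
  obtain e :: "real^'n" where "norm e = 1" using vector_choose_size[of 1] by auto
  then have "\<mu> \<le> L" using below'[of e] L(2)[of e] by simp
  \<comment> \<open>This \<open>t\<close> minimises the bound \<open>1 - 2 t \<mu> + t\<^sup>2 L\<^sup>2\<close> for the squared norm of \<open>1 - t M\<close>.\<close>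
  define t where "t = \<mu> / L\<^sup>2"
  have t: "t > 0" using mu L by (simp add: t_def)
  define q where "q = sqrt (1 - \<mu>\<^sup>2 / L\<^sup>2)"
  have "\<mu>\<^sup>2 / L\<^sup>2 \<le> 1" using \<open>\<mu> \<le> L\<close> mu L(1) by (simp add: divide_simps power_mono)
  then have q2: "q\<^sup>2 = 1 - \<mu>\<^sup>2 / L\<^sup>2" and q0: "0 \<le> q" by (simp_all add: q_def)
  have q1: "q < 1" using mu L(1) by (simp add: q_def)
  define C where "C = id_blinfun - t *\<^sub>R Blinfun (\<lambda>v. M *v v)"
  have Capp: "blinfun_apply C v = v - t *\<^sub>R (M *v v)" for v
    by (simp add: C_def bounded_linear_Blinfun_apply blinfun.bilinear_simps)
  have "norm (v - t *\<^sub>R (M *v v)) \<le> q * norm v" for v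
  proof -
    have "(norm (v - t *\<^sub>R (M *v v)))\<^sup>2 = (norm v)\<^sup>2 - 2 * t * (v \<bullet> (M *v v)) + t\<^sup>2 * (norm (M *v v))\<^sup>2"
      by (simp only: power2_norm_eq_inner) (simp add: algebra_simps inner_commute power2_eq_square)
    also have "\<dots> \<le> (norm v)\<^sup>2 - 2 * t * (\<mu> * (norm v)\<^sup>2) + t\<^sup>2 * (norm v * L)\<^sup>2"
    proof -
      have "2 * t * (\<mu> * (norm v)\<^sup>2) \<le> 2 * t * (v \<bullet> (M *v v))"
        using below[of v] t by simp
      moreover have "t\<^sup>2 * (norm (M *v v))\<^sup>2 \<le> t\<^sup>2 * (norm v * L)\<^sup>2"
        using L(2)[of v] by (intro mult_left_mono power_mono) auto
      ultimately show ?thesis by linarith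
    qed
    also have "\<dots> = (q * norm v)\<^sup>2"
      using L(1) unfolding power_mult_distrib q2 t_def
      by (simp add: field_simps power2_eq_square)
    finally show ?thesis by (rule power2_le_imp_le) (simp add: q0)
  qed
  then have Cq: "norm C \<le> q" by (intro norm_blinfun_bound q0) (simp add: Capp)
  define S where "S = {Y :: (real^'n) \<Rightarrow>\<^sub>L (real^'n). norm Y \<le> q \<and> (\<forall>u v. blinfun_apply Y u \<bullet> v = u \<bullet> blinfun_apply Y v)}"
  define f where "f Y = (1/2) *\<^sub>R (C + (Y o\<^sub>L Y))" for Y
  have "closed S"
  proof -
    have "S = cball 0 q \<inter> (\<Inter>u. \<Inter>v. {Y. blinfun_apply Y u \<bullet> v = u \<bullet> blinfun_apply Y v})"
      by (auto simp: S_def)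
    moreover have "closed {Y :: (real^'n) \<Rightarrow>\<^sub>L (real^'n). blinfun_apply Y u \<bullet> v = u \<bullet> blinfun_apply Y v}" for u v
      by (intro closed_Collect_eq continuous_intros)
    ultimately show ?thesis by (metis (no_types, lifting) closed_INT closed_Int closed_cball)
  qed
  note this[folded complete_eq_closed]
  moreover have "0 \<in> S" using q0 by (simp add: S_def)
  moreover have "f ` S \<subseteq> S"
  proof safe
    fix Y assume Y: "Y \<in> S"
    have "norm (Y o\<^sub>L Y) \<le> q * q"
      using norm_blinfun_compose[of Y Y] Y mult_mono[of "norm Y" q "norm Y" q] q0 by (simp add: S_def)
    moreover have "q * q \<le> q" using q0 q1 by (simp add: mult_left_le)
    ultimately have "norm (f Y) \<le> q"
      using Cq norm_triangle_ineq[of C "Y o\<^sub>L Y"] unfolding f_def by simp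
    moreover have "f Y u \<bullet> v = u \<bullet> f Y v" for u v
    proof -
      have "Y (Y u) \<bullet> v = u \<bullet> Y (Y v)" using Y by (simp add: S_def)
      moreover have "C u \<bullet> v = u \<bullet> C v"
        using M by (simp add: Capp inner_simps pos_def_def inner_symmetric_matrix)
      ultimately show ?thesis by (simp add: f_def blinfun.bilinear_simps inner_simps)
    qed
    ultimately show "f Y \<in> S" by (simp add: S_def)
  qed
  moreover have "dist (f Y) (f Z) \<le> q * dist Y Z" if "Y \<in> S" "Z \<in> S" for Y Z
  proof -
    have "f Y - f Z = (1/2) *\<^sub>R ((Y o\<^sub>L (Y - Z)) + ((Y - Z) o\<^sub>L Z))"
      by (rule blinfun_eqI) (simp add: f_def blinfun.bilinear_simps algebra_simps)
    moreover have "norm (Y o\<^sub>L (Y - Z)) \<le> q * norm (Y - Z)"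
      using norm_blinfun_compose[of Y "Y - Z"] that mult_right_mono[of "norm Y" q "norm (Y - Z)"]
      by (simp add: S_def)
    moreover have "norm ((Y - Z) o\<^sub>L Z) \<le> q * norm (Y - Z)"
      using norm_blinfun_compose[of "Y - Z" Z] that mult_left_mono[of "norm Z" q "norm (Y - Z)"]
      by (simp add: S_def mult.commute)
    ultimately show ?thesis
      using norm_triangle_ineq[of "Y o\<^sub>L (Y - Z)" "(Y - Z) o\<^sub>L Z"]
      by (simp add: dist_norm)
  qed
  ultimately obtain Y where Y: "Y \<in> S" "f Y = Y"
    using Banach_fix[of S q f] q0 q1 by blast
  define g where "g v = (1 / sqrt t) *\<^sub>R (v - blinfun_apply Y v)" for v
  have lin: "linear g"
    unfolding g_def
    by (intro linear_compose_scale_right linear_compose_sub linear_ident bounded_linear.linear blinfun.bounded_linear_right)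
  define A where "A = matrix g"
  have A: "A *v v = g v" for v
    unfolding A_def using lin by (simp add: matrix_works)
  have "A *v (A *v v) = M *v v" for v
  proof -
    have "Y v = (1/2) *\<^sub>R (C v + Y (Y v))"
      using arg_cong[OF Y(2), of "\<lambda>T. blinfun_apply T v"] by (simp add: f_def blinfun.bilinear_simps)
    then have "2 *\<^sub>R Y v = C v + Y (Y v)" by (metis (no_types, lifting) divideR_right scaleR_scaleR inverse_eq_divide zero_neq_numeral)
    then have e: "v - 2 *\<^sub>R Y v + Y (Y v) = t *\<^sub>R (M *v v)" by (simp add: Capp algebra_simps)
    have "g (g v) = (1 / sqrt t * (1 / sqrt t)) *\<^sub>R (v - 2 *\<^sub>R Y v + Y (Y v))"
      by (simp add: g_def blinfun.bilinear_simps algebra_simps scaleR_2)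
    also have "\<dots> = M *v v" using t unfolding e by simp
    finally show ?thesis by (simp add: A)
  qed
  then have "A ** A = M"
    by (simp add: matrix_eq matrix_vector_mul_assoc[symmetric])
  moreover have "transpose A = A"
  proof -
    have "(A *v u) \<bullet> v = u \<bullet> (A *v v)" for u v
      using Y(1) by (simp add: A g_def S_def inner_simps)
    then have "(transpose A *v v) \<bullet> u = (A *v v) \<bullet> u" for u v
      by (metis dot_lmul_matrix inner_commute transpose_matrix_vector)
    then have "transpose A *v v = A *v v" for v
      using vector_eq_rdot by blast
    then show ?thesis by (simp add: matrix_eq)
  qed
  moreover have "0 < v \<bullet> (A *v v)" if "v \<noteq> 0" for v
  proof -
    have "v \<bullet> Y v \<le> norm v * (q * norm v)"
    proof -
      have "norm (Y v) \<le> q * norm v"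
        using norm_blinfun[of Y v] Y(1) mult_right_mono[of "norm Y" q "norm v"] by (simp add: S_def)
      then have "norm v * norm (Y v) \<le> norm v * (q * norm v)" by (intro mult_left_mono) auto
      then show ?thesis using norm_cauchy_schwarz[of v "Y v"] by linarith
    qed
    moreover have "norm v * (q * norm v) < norm v * norm v" using that q1 by simp
    ultimately have "v \<bullet> Y v < v \<bullet> v" by (simp add: power2_norm_eq_inner[symmetric] power2_eq_square)
    then show ?thesis using t by (simp add: A g_def inner_simps)
  qed
  ultimately show ?thesis unfolding pos_def_def by blast
qed

lemma trace_conj_eq:
  fixes D B :: "real ^ 'n ^ 'n"
  assumes "transpose D = D"
  shows "trace (D ** B ** D) = (\<Sum>k\<in>UNIV. (D *v axis k 1) \<bullet> (B *v (D *v axis k 1)))"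
proof -
  have "trace (D ** B ** D) = (\<Sum>k\<in>UNIV. axis k 1 \<bullet> ((D ** B ** D) *v axis k 1))"
    by (simp add: trace_def matrix_vector_mult_basis column_def inner_axis')
  also have "\<dots> = (\<Sum>k\<in>UNIV. (D *v axis k 1) \<bullet> (B *v (D *v axis k 1)))"
    by (simp add: matrix_vector_mul_assoc[symmetric] inner_symmetric_matrix[OF assms])
  finally show ?thesis .
qed

text \<open>
  For \<open>D = A - B\<close> the hypothesis says \<open>A D + D B = 0\<close>.  Multiplying by \<open>D\<close> and taking the trace gives
  \<open>tr (D A D) + tr (D B D) = 0\<close>, a sum of nonnegative terms in which \<open>A\<close> is positive on every nonzero column
  of \<open>D\<close>.
\<close>

lemma pos_def_sqrt_unique:
  fixes A B :: "real ^ 'n ^ 'n"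
  assumes A: "pos_def A" and B: "pos_def B" and eq: "A ** A = B ** B"
  shows "A = B"
proof -
  define D where "D = A - B"
  have tD: "transpose D = D"
    using A B by (simp add: D_def pos_def_def transpose_def vec_eq_iff)
  have z: "A ** D + D ** B = 0"
  proof -
    have "A *v (A *v v) = B *v (B *v v)" for v
      using eq by (metis matrix_vector_mul_assoc)
    then show ?thesis
      by (simp add: D_def matrix_eq matrix_vector_mult_add_rdistrib matrix_vector_mult_diff_rdistrib
          matrix_vector_mul_assoc[symmetric] matrix_vector_mult_diff_distrib)
  qed
  have "trace (D ** A ** D) + trace (D ** B ** D) = trace (D ** (A ** D)) + trace (D ** (D ** B))"
    by (metis matrix_mul_assoc trace_mul_sym)
  also have "\<dots> = trace (D ** (A ** D + D ** B))"
    by (simp add: matrix_add_ldistrib trace_add)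
  also have "\<dots> = 0" unfolding z by (simp add: trace_def matrix_matrix_mult_def)
  finally have sum0: "(\<Sum>k\<in>UNIV. (D *v axis k 1) \<bullet> (A *v (D *v axis k 1)) + (D *v axis k 1) \<bullet> (B *v (D *v axis k 1))) = 0"
    by (simp add: trace_conj_eq[OF tD] sum.distrib)
  have nn: "0 \<le> v \<bullet> (A *v v)" "0 \<le> v \<bullet> (B *v v)" for v
    using A B unfolding pos_def_def by (cases "v = 0"; force)+
  have Dk: "D *v axis k 1 = 0" for k
  proof (rule ccontr)
    assume ne: "D *v axis k 1 \<noteq> 0"
    have "(D *v axis k 1) \<bullet> (A *v (D *v axis k 1)) + (D *v axis k 1) \<bullet> (B *v (D *v axis k 1)) = 0"
      using sum0 nn by (subst (asm) sum_nonneg_eq_0_iff) (auto intro: add_nonneg_nonneg)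
    moreover have "0 < (D *v axis k 1) \<bullet> (A *v (D *v axis k 1))"
      using A ne unfolding pos_def_def by blast
    ultimately show False using nn(2)[of "D *v axis k 1"] by linarith
  qed
  have "D $ i $ k = 0" for i k
    using arg_cong[OF Dk[of k], of "\<lambda>v. v $ i"] by (simp add: matrix_vector_mult_basis column_def)
  then show ?thesis by (simp add: D_def vec_eq_iff)
qed

lemma matrix_sqrt_works:
  fixes M :: "real ^ 'n ^ 'n"
  assumes "pos_def M"
  shows "pos_def (matrix_sqrt M)" "matrix_sqrt M ** matrix_sqrt M = M"
proof -
  have "\<exists>!A. pos_def A \<and> A ** A = M"
    using pos_def_sqrt_exists[OF assms] pos_def_sqrt_unique by metis
  from theI'[OF this] show "pos_def (matrix_sqrt M)" "matrix_sqrt M ** matrix_sqrt M = M"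
    unfolding matrix_sqrt_def by auto
qed

section \<open>Calculus for functions of class C2\<close>

lemma derivative_along_line:
  fixes f :: "real ^ 'n \<Rightarrow> real"
  assumes "f differentiable (at (p + t *\<^sub>R v))"
  shows "((\<lambda>s. f (p + s *\<^sub>R v)) has_real_derivative frechet_derivative f (at (p + t *\<^sub>R v)) v) (at t)"
proof -
  have f: "(f has_derivative frechet_derivative f (at (p + t *\<^sub>R v))) (at (p + t *\<^sub>R v))"
    using assms frechet_derivative_works by blast
  have "((\<lambda>s. p + s *\<^sub>R v) has_derivative (\<lambda>s. s *\<^sub>R v)) (at t)"
    by (auto intro!: derivative_eq_intros)
  from has_derivative_compose[OF this f]
  have "((\<lambda>s. f (p + s *\<^sub>R v)) has_derivative (\<lambda>s. frechet_derivative f (at (p + t *\<^sub>R v)) (s *\<^sub>R v))) (at t)" .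
  moreover have "frechet_derivative f (at (p + t *\<^sub>R v)) (s *\<^sub>R v)
      = frechet_derivative f (at (p + t *\<^sub>R v)) v * s" for s
    using linear_frechet_derivative[OF assms] by (simp add: linear_cmul)
  ultimately show ?thesis by (simp add: has_field_derivative_def)
qed

lemma frechet_derivative_eq_gradient:
  fixes f :: "real ^ 'n \<Rightarrow> real"
  assumes "f differentiable (at x)"
  shows "frechet_derivative f (at x) v = gradient f x \<bullet> v"
proof -
  have "frechet_derivative f (at x) v = frechet_derivative f (at x) (\<Sum>i\<in>UNIV. v $ i *\<^sub>R axis i 1)"
    by (simp add: basis_expansion[of v, unfolded scalar_mult_eq_scaleR])
  also have "\<dots> = (\<Sum>i\<in>UNIV. v $ i * partial_deriv i f x)"
    using linear_frechet_derivative[OF assms]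
    by (simp add: linear_sum linear_cmul partial_deriv_def)
  finally show ?thesis by (simp add: gradient_def inner_vec_def mult.commute)
qed

lemma C2_line:
  assumes "C2 f"
  shows "((\<lambda>t. f (p + t *\<^sub>R axis i 1)) has_real_derivative partial_deriv i f (p + t *\<^sub>R axis i 1)) (at t)"
    and "((\<lambda>t. partial_deriv i f (p + t *\<^sub>R axis i 1)) has_real_derivative
            partial_deriv i (partial_deriv i f) (p + t *\<^sub>R axis i 1)) (at t)"
  using assms derivative_along_line[of f p t "axis i 1"]
    derivative_along_line[of "partial_deriv i f" p t "axis i 1"]
  unfolding C2_def partial_deriv_def by blast+

lemma C2_continuous: "C2 f \<Longrightarrow> continuous_on S f"
  unfolding C2_def
  by (meson continuous_at_imp_continuous_on differentiable_imp_continuous_within)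

lemma second_derivative_nonneg_at_min:
  fixes f f' :: "real \<Rightarrow> real"
  assumes f: "\<And>t. (f has_real_derivative f' t) (at t)"
    and f': "(f' has_real_derivative D) (at a)"
    and min: "eventually (\<lambda>t. f a \<le> f t) (at a)"
  shows "f' a = 0" "0 \<le> D"
proof -
  obtain d where d: "d > 0" "\<And>t. t \<noteq> a \<Longrightarrow> dist t a < d \<Longrightarrow> f a \<le> f t"
    using min unfolding eventually_at by auto
  show z: "f' a = 0"
  proof (rule DERIV_local_min[OF f d(1)])
    show "\<forall>y. \<bar>a - y\<bar> < d \<longrightarrow> f a \<le> f y"
      using d(2) by (metis dist_commute dist_real_def order_refl)
  qed
  show "0 \<le> D"
  proof (rule ccontr)
    assume "\<not> 0 \<le> D"
    then obtain e where e: "e > 0" "\<And>h. 0 < h \<Longrightarrow> h < e \<Longrightarrow> f' (a + h) < f' a"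
      using has_real_derivative_neg_dec_right[of f' D a UNIV] f' by auto
    define t where "t = a + min d e / 2"
    have t: "a < t" "dist t a < d" "t < a + e" using d(1) e(1) by (auto simp: t_def dist_real_def min_def)
    obtain s where s: "a < s" "s < t" "f t - f a = (t - a) * f' s"
      using MVT2[OF t(1), of f f'] f by blast
    have "f' s < 0" using e(2)[of "s - a"] s t z by auto
    then have "f t < f a" using s(3) t(1) by (smt (verit) mult_pos_neg)
    then show False using d(2)[of t] t by auto
  qed
qed

lemma eventually_along_axis:
  fixes p :: "real ^ 'n"
  assumes "eventually P (at p)"
  shows "eventually (\<lambda>t. P (p + t *\<^sub>R axis i 1)) (at (0::real))"
proof -
  have "((\<lambda>t::real. p + t *\<^sub>R axis i 1) \<longlongrightarrow> p + 0 *\<^sub>R axis i 1) (at 0)"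
    by (intro tendsto_intros)
  moreover have "eventually (\<lambda>t::real. p + t *\<^sub>R axis i 1 \<noteq> p) (at 0)"
    by (auto simp: eventually_at axis_eq_0_iff intro!: exI[of _ 1])
  ultimately have "filterlim (\<lambda>t::real. p + t *\<^sub>R axis i 1) (at p) (at 0)"
    by (simp add: filterlim_at)
  then show ?thesis using assms by (simp add: filterlim_iff)
qed

section \<open>Touching conditions\<close>

text \<open>
  First and second order conditions at a maximum of the difference between a function and its
  translate.
\<close>

lemma translation_touching:
  fixes w :: "real ^ 'n \<Rightarrow> real"
  assumes w: "C2 w" and max: "\<And>y. w (y + z) - w y \<le> w (p + z) - w p"
  shows "gradient w (p + z) = gradient w p" "laplacian w (p + z) \<le> laplacian w p"
proof -
  have *: "partial_deriv i w p - partial_deriv i w (p + z) = 0 \<and>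
      0 \<le> partial_deriv i (partial_deriv i w) p - partial_deriv i (partial_deriv i w) (p + z)" for i
  proof -
    let ?f = "\<lambda>t. w (p + t *\<^sub>R axis i 1) - w ((p + z) + t *\<^sub>R axis i 1)"
    let ?f' = "\<lambda>t. partial_deriv i w (p + t *\<^sub>R axis i 1) - partial_deriv i w ((p + z) + t *\<^sub>R axis i 1)"
    have 1: "(?f has_real_derivative ?f' t) (at t)" for t
      by (intro DERIV_diff C2_line w)
    have 2: "(?f' has_real_derivative
       (partial_deriv i (partial_deriv i w) (p + 0 *\<^sub>R axis i 1)
         - partial_deriv i (partial_deriv i w) ((p + z) + 0 *\<^sub>R axis i 1))) (at 0)"
      by (intro DERIV_diff C2_line w)
    have "?f 0 \<le> ?f t" for t
      using max[of "p + t *\<^sub>R axis i 1"] by (simp add: algebra_simps)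
    then have 3: "eventually (\<lambda>t. ?f 0 \<le> ?f t) (at 0)" by simp
    show ?thesis using second_derivative_nonneg_at_min[of ?f ?f', OF 1 2 3] by simp
  qed
  show "gradient w (p + z) = gradient w p"
    using * by (simp add: gradient_def vec_eq_iff)
  have "0 \<le> (\<Sum>i\<in>UNIV. partial_deriv i (partial_deriv i w) p - partial_deriv i (partial_deriv i w) (p + z))"
    using * by (intro sum_nonneg) auto
  then show "laplacian w (p + z) \<le> laplacian w p"
    by (simp add: laplacian_def sum_subtractf)
qed

text \<open>
  For \<open>a = 1\<close> this is the ground state of the harmonic oscillator \<open>- \<epsilon>\<^sup>2 \<Delta> + \<bar>A y\<bar>\<^sup>2\<close>.  The factor \<open>a\<close> narrows
  or widens it; negative \<open>a\<close> gives a function that grows away from the origin.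
\<close>

definition gauss :: "real \<Rightarrow> real \<Rightarrow> real ^ 'n ^ 'n \<Rightarrow> real ^ 'n \<Rightarrow> real" where
  "gauss \<epsilon> a A y = exp (- (a * (y \<bullet> (A *v y))) / (2 * \<epsilon>))"

text \<open>
  Since \<open>\<epsilon>\<^sup>2 \<Delta> exp (- w / \<epsilon>) = exp (- w / \<epsilon>) (\<bar>Dw\<bar>\<^sup>2 - \<epsilon> \<Delta>w)\<close> and
  \<open>\<epsilon>\<^sup>2 \<Delta> gauss = gauss (a\<^sup>2 \<bar>A y\<bar>\<^sup>2 - a \<epsilon> tr A)\<close>, the inequality says that the Laplacian of
  \<open>N gauss + B - L exp (- w / \<epsilon>)\<close> is nonnegative at a local minimum.  The signs of \<open>N\<close> and \<open>L\<close> are free, so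
  that barriers from above and from below are both covered.
\<close>

lemma barrier_touching:
  fixes w :: "real ^ 'n \<Rightarrow> real" and A :: "real ^ 'n ^ 'n"
  assumes A: "transpose A = A" and w: "C2 w" and eps: "0 < \<epsilon>"
    and min: "eventually (\<lambda>y. N * gauss \<epsilon> a A (p - z) + B - L * exp (- w p / \<epsilon>)
                  \<le> N * gauss \<epsilon> a A (y - z) + B - L * exp (- w y / \<epsilon>)) (at p)"
  shows "L * exp (- w p / \<epsilon>) * ((norm (gradient w p))\<^sup>2 - \<epsilon> * laplacian w p)
      \<le> N * gauss \<epsilon> a A (p - z) * (a\<^sup>2 * (norm (A *v (p - z)))\<^sup>2 - a * \<epsilon> * trace A)"
proof -
  define v where "v = A *v (p - z)"
  define G where "G = gauss \<epsilon> a A (p - z)"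
  define u where "u = exp (- w p / \<epsilon>)"
  have *: "0 \<le> N * G * ((a * v $ i / \<epsilon>)\<^sup>2 - a * A $ i $ i / \<epsilon>)
      - L * u * ((partial_deriv i w p / \<epsilon>)\<^sup>2 - partial_deriv i (partial_deriv i w) p / \<epsilon>)" for i
  proof -
    let ?e = "axis i 1 :: real ^ 'n"
    let ?q = "\<lambda>t. - (a * ((p - z) \<bullet> v + 2 * t * v $ i + t\<^sup>2 * A $ i $ i)) / (2 * \<epsilon>)"
    let ?f = "\<lambda>t. N * exp (?q t) + B - L * exp (- w (p + t *\<^sub>R ?e) / \<epsilon>)"
    let ?f' = "\<lambda>t. N * (exp (?q t) * (- (a * (v $ i + t * A $ i $ i)) / \<epsilon>))
        - L * (exp (- w (p + t *\<^sub>R ?e) / \<epsilon>) * (- partial_deriv i w (p + t *\<^sub>R ?e) / \<epsilon>))"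
    \<comment> \<open>Along a coordinate axis the exponent is quadratic, so one-variable calculus suffices.\<close>
    have q: "gauss \<epsilon> a A (p + t *\<^sub>R ?e - z) = exp (?q t)" for t
    proof -
      have e1: "?e \<bullet> (A *v (p - z)) = v $ i" by (simp add: v_def inner_axis')
      have e2: "(p - z) \<bullet> (A *v ?e) = v $ i"
        using inner_symmetric_matrix[OF A, of "p - z" ?e] by (simp add: v_def inner_axis)
      have e3: "?e \<bullet> (A *v ?e) = A $ i $ i"
        by (simp add: matrix_vector_mult_basis column_def inner_axis')
      have "p + t *\<^sub>R ?e - z = (p - z) + t *\<^sub>R ?e" by simp
      then have "(p + t *\<^sub>R ?e - z) \<bullet> (A *v (p + t *\<^sub>R ?e - z))
          = ((p - z) + t *\<^sub>R ?e) \<bullet> (A *v (p - z) + t *\<^sub>R (A *v ?e))"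
        by (simp only: matrix_vector_right_distrib matrix_vector_mult_scaleR)
      also have "\<dots> = (p - z) \<bullet> v + 2 * t * v $ i + t\<^sup>2 * A $ i $ i"
        by (simp only: inner_add_left inner_add_right inner_scaleR_left inner_scaleR_right e1 e2 e3)
          (simp add: v_def power2_eq_square algebra_simps)
      finally show ?thesis by (simp add: gauss_def)
    qed
    have 1: "(?f has_real_derivative ?f' t) (at t)" for t
      using eps by (auto intro!: derivative_eq_intros C2_line(1)[OF w]
          simp: divide_simps power2_eq_square algebra_simps)
    have 2: "(?f' has_real_derivative
        (N * (exp (?q 0) * ((a * v $ i / \<epsilon>)\<^sup>2 - a * A $ i $ i / \<epsilon>))
         - L * (exp (- w (p + 0 *\<^sub>R ?e) / \<epsilon>) * ((partial_deriv i w (p + 0 *\<^sub>R ?e) / \<epsilon>)\<^sup>2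
             - partial_deriv i (partial_deriv i w) (p + 0 *\<^sub>R ?e) / \<epsilon>)))) (at 0)"
      using eps by (auto intro!: derivative_eq_intros C2_line[OF w]
          simp: divide_simps power2_eq_square algebra_simps)
    have 3: "eventually (\<lambda>t. ?f 0 \<le> ?f t) (at 0)"
      using eventually_along_axis[OF min, of i] unfolding q by (simp add: gauss_def v_def)
    show ?thesis
      using second_derivative_nonneg_at_min(2)[of ?f ?f', OF 1 2 3] q[of 0]
      by (simp add: G_def u_def mult.assoc)
  qed
  have "0 \<le> \<epsilon>\<^sup>2 * (\<Sum>i\<in>UNIV. N * G * ((a * v $ i / \<epsilon>)\<^sup>2 - a * A $ i $ i / \<epsilon>)
      - L * u * ((partial_deriv i w p / \<epsilon>)\<^sup>2 - partial_deriv i (partial_deriv i w) p / \<epsilon>))"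
    using * by (intro mult_nonneg_nonneg sum_nonneg) auto
  also have "\<dots> = (\<Sum>i\<in>UNIV. N * G * (a\<^sup>2 * (v $ i)\<^sup>2 - a * \<epsilon> * A $ i $ i)
      - L * u * ((partial_deriv i w p)\<^sup>2 - \<epsilon> * partial_deriv i (partial_deriv i w) p))"
    unfolding sum_distrib_left
    using eps by (intro sum.cong) (simp_all add: field_simps power2_eq_square)
  also have "\<dots> = N * G * (a\<^sup>2 * (norm v)\<^sup>2 - a * \<epsilon> * trace A)
      - L * u * ((norm (gradient w p))\<^sup>2 - \<epsilon> * laplacian w p)"
    unfolding power2_norm_eq_inner
    by (simp add: sum_subtractf sum_distrib_left trace_def laplacian_def gradient_def
        inner_vec_def power2_eq_square right_diff_distrib)
  finally show ?thesis by (simp add: v_def G_def u_def)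
qed

section \<open>The potential near a nondegenerate zero\<close>

text \<open>
  The gradient of \<open>V\<close> vanishes at the minimum \<open>z\<close> and is differentiable there, hence linear up to
  \<open>o(\<bar>y\<bar>)\<close>; the mean value theorem along the segment from \<open>z\<close> to \<open>z + y\<close> integrates this.
\<close>

lemma taylor_at_zero_min:
  fixes V :: "real ^ 'n \<Rightarrow> real"
  assumes V: "C2 V" and nonneg: "\<And>y. 0 \<le> V y" and zero: "V z = 0" and e: "0 < e"
  shows "\<exists>d>0. \<forall>y. norm y < d \<longrightarrow> \<bar>V (z + y) - (y \<bullet> (hessian V z *v y)) / 2\<bar> \<le> e * (norm y)\<^sup>2"
proof -
  define e' where "e' = e / real CARD('n)"
  have e': "e' > 0" using e by (simp add: e'_def)
  have grad0: "partial_deriv k V z = 0" for k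
    using second_derivative_nonneg_at_min(1)[OF C2_line[OF V, where p = z and i = k], of 0]
    by (simp add: nonneg zero)
  have "eventually (\<lambda>y. \<bar>partial_deriv k V (z + y) - (\<Sum>l\<in>UNIV. y $ l * hessian V z $ l $ k)\<bar> \<le> e' * norm y) (nhds 0)" for k
  proof -
    let ?g = "partial_deriv k V"
    have d: "?g differentiable (at z)" using V by (simp add: C2_def)
    then have "(?g has_derivative frechet_derivative ?g (at z)) (at z)"
      using frechet_derivative_works by blast
    then obtain d where d0: "d > 0"
      and dd: "\<And>y. norm (y - z) < d \<Longrightarrow> norm (?g y - ?g z - frechet_derivative ?g (at z) (y - z)) \<le> e' * norm (y - z)"
      using e' unfolding has_derivative_at_alt by blast
    have "\<bar>?g (z + y) - (\<Sum>l\<in>UNIV. y $ l * hessian V z $ l $ k)\<bar> \<le> e' * norm y" if "norm y < d" for y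
      using dd[of "z + y"] that
      by (simp add: grad0 frechet_derivative_eq_gradient[OF d] gradient_def hessian_def inner_vec_def mult.commute)
    then show ?thesis using d0 by (auto simp: eventually_nhds_metric dist_norm)
  qed
  then have "eventually (\<lambda>y. \<forall>k. \<bar>partial_deriv k V (z + y) - (\<Sum>l\<in>UNIV. y $ l * hessian V z $ l $ k)\<bar> \<le> e' * norm y) (nhds 0)"
    by (simp add: eventually_all_finite)
  then obtain d where d: "d > 0" and
    dd: "\<And>y k. norm y < d \<Longrightarrow> \<bar>partial_deriv k V (z + y) - (\<Sum>l\<in>UNIV. y $ l * hessian V z $ l $ k)\<bar> \<le> e' * norm y"
    by (auto simp: eventually_nhds_metric dist_norm)
  have "\<bar>V (z + y) - (y \<bullet> (hessian V z *v y)) / 2\<bar> \<le> e * (norm y)\<^sup>2" if y: "norm y < d" for y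
  proof -
    let ?g = "\<lambda>t. V (z + t *\<^sub>R y) - t\<^sup>2 * (y \<bullet> (hessian V z *v y)) / 2"
    let ?g' = "\<lambda>t. frechet_derivative V (at (z + t *\<^sub>R y)) y - t * (y \<bullet> (hessian V z *v y))"
    have diff: "V differentiable (at x)" for x using V by (simp add: C2_def)
    have "(?g has_real_derivative ?g' t) (at t)" for t
      by (auto intro!: derivative_eq_intros derivative_along_line diff)
    then obtain s where s: "0 < s" "s < 1" "?g 1 - ?g 0 = (1 - 0) * ?g' s"
      using MVT2[of 0 1 ?g ?g'] by auto
    have sy: "norm (s *\<^sub>R y) \<le> norm y" using s(1,2) by (simp add: mult_left_le_one_le)
    have "y \<bullet> (hessian V z *v y) = (\<Sum>l\<in>UNIV. \<Sum>k\<in>UNIV. y $ l * (hessian V z $ l $ k * y $ k))"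
      by (simp add: inner_vec_def matrix_vector_mult_def sum_distrib_left)
    also have "\<dots> = (\<Sum>k\<in>UNIV. \<Sum>l\<in>UNIV. y $ l * (hessian V z $ l $ k * y $ k))"
      by (rule sum.swap)
    finally have "?g' s = (\<Sum>k\<in>UNIV. y $ k * (partial_deriv k V (z + s *\<^sub>R y)
        - (\<Sum>l\<in>UNIV. (s *\<^sub>R y) $ l * hessian V z $ l $ k)))"
      by (simp add: frechet_derivative_eq_gradient[OF diff] gradient_def inner_vec_def
          right_diff_distrib sum_subtractf sum_distrib_left mult_ac)
    then have "\<bar>?g' s\<bar> \<le> (\<Sum>k\<in>UNIV. \<bar>y $ k * (partial_deriv k V (z + s *\<^sub>R y)
        - (\<Sum>l\<in>UNIV. (s *\<^sub>R y) $ l * hessian V z $ l $ k))\<bar>)"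
      by (simp only: sum_abs)
    also have "\<dots> \<le> (\<Sum>k\<in>(UNIV::'n set). norm y * (e' * norm y))"
    proof (rule sum_mono)
      fix k
      have "\<bar>partial_deriv k V (z + s *\<^sub>R y) - (\<Sum>l\<in>UNIV. (s *\<^sub>R y) $ l * hessian V z $ l $ k)\<bar>
          \<le> e' * norm (s *\<^sub>R y)"
        using dd[of "s *\<^sub>R y" k] sy y by linarith
      also have "\<dots> \<le> e' * norm y" using sy e' by (intro mult_left_mono) auto
      finally show "\<bar>y $ k * (partial_deriv k V (z + s *\<^sub>R y)
          - (\<Sum>l\<in>UNIV. (s *\<^sub>R y) $ l * hessian V z $ l $ k))\<bar> \<le> norm y * (e' * norm y)"
        unfolding abs_mult by (intro mult_mono component_le_norm_cart) auto
    qed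
    also have "\<dots> = e * (norm y)\<^sup>2" by (simp add: e'_def power2_eq_square)
    finally show ?thesis using s(3) zero by simp
  qed
  with d show ?thesis by blast
qed

text \<open>
  The Taylor error \<open>o(\<bar>y\<bar>\<^sup>2)\<close> is absorbed into a factor close to 1 because \<open>\<bar>A y\<bar>\<close> is at least a
  multiple of \<open>\<bar>y\<bar>\<close>.
\<close>

lemma nondegenerate_zero_bounds:
  fixes V :: "real ^ 'n \<Rightarrow> real"
  assumes V: "C2 V" and nonneg: "\<And>y. 0 \<le> V y" and zero: "V z = 0"
    and A: "pos_def A" "A ** A = (1/2) *\<^sub>R hessian V z"
    and lo: "lo < 1" and hi: "1 < hi"
  shows "\<exists>d>0. \<forall>y. norm y \<le> d \<longrightarrow>
           lo * (norm (A *v y))\<^sup>2 \<le> V (z + y) \<and> V (z + y) \<le> hi * (norm (A *v y))\<^sup>2"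
proof -
  obtain \<mu> where mu: "\<mu> > 0" "\<And>y. \<mu> * norm y \<le> norm (A *v y)"
    using bounded_below_pos_def[OF A(1)] by metis
  define e where "e = min (1 - lo) (hi - 1) * \<mu>\<^sup>2"
  have e: "e > 0" using lo hi mu by (simp add: e_def)
  obtain d where d: "d > 0" and
    dd: "\<And>y. norm y < d \<Longrightarrow> \<bar>V (z + y) - (y \<bullet> (hessian V z *v y)) / 2\<bar> \<le> e * (norm y)\<^sup>2"
    using taylor_at_zero_min[OF V nonneg zero e] by auto
  have "lo * (norm (A *v y))\<^sup>2 \<le> V (z + y) \<and> V (z + y) \<le> hi * (norm (A *v y))\<^sup>2" if "norm y < d" for y
  proof -
    have "(y \<bullet> (hessian V z *v y)) / 2 = y \<bullet> ((A ** A) *v y)"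
      unfolding A(2) by (simp add: scaleR_matrix_vector_assoc[symmetric])
    also have "\<dots> = (norm (A *v y))\<^sup>2"
      using A(1) by (simp add: matrix_vector_mul_assoc[symmetric] pos_def_def inner_symmetric_matrix power2_norm_eq_inner)
    finally have 1: "\<bar>V (z + y) - (norm (A *v y))\<^sup>2\<bar> \<le> e * (norm y)\<^sup>2"
      using dd[OF that] by simp
    have "(\<mu> * norm y)\<^sup>2 \<le> (norm (A *v y))\<^sup>2"
      using mu by (intro power_mono) auto
    then have "min (1 - lo) (hi - 1) * (\<mu> * norm y)\<^sup>2 \<le> min (1 - lo) (hi - 1) * (norm (A *v y))\<^sup>2"
      using lo hi by (intro mult_left_mono) auto
    then have 2: "e * (norm y)\<^sup>2 \<le> min (1 - lo) (hi - 1) * (norm (A *v y))\<^sup>2"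
      by (simp add: e_def power_mult_distrib mult.assoc)
    have "min (1 - lo) (hi - 1) * (norm (A *v y))\<^sup>2 \<le> (1 - lo) * (norm (A *v y))\<^sup>2"
      "min (1 - lo) (hi - 1) * (norm (A *v y))\<^sup>2 \<le> (hi - 1) * (norm (A *v y))\<^sup>2"
      by (intro mult_right_mono; simp)+
    with 1 2 show ?thesis by (simp add: algebra_simps abs_le_iff)
  qed
  then show ?thesis using d by (intro exI[of _ "d/2"]) auto
qed

section \<open>Comparison with Gaussian barriers\<close>

lemma gauss_pos: "0 < gauss \<epsilon> a A y"
  by (simp add: gauss_def)

lemma continuous_on_gauss [continuous_intros]:
  fixes z :: "real ^ 'n"
  shows "continuous_on S (\<lambda>x. gauss \<epsilon> a A (x - z))"
  unfolding gauss_def divide_inverse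
  by (intro continuous_on_exp continuous_on_mult continuous_on_minus continuous_on_inner
      bounded_linear.continuous_on[OF matrix_vector_mul_bounded_linear]
      continuous_on_const continuous_on_diff continuous_on_id)

lemma classical_solutionD:
  assumes "classical_solution \<alpha> \<epsilon> V w"
  shows "C2 w" "periodic w"
    "(norm (gradient w x))\<^sup>2 - \<epsilon> * laplacian w x = V x - \<epsilon> powr \<alpha> * w x"
  using assms unfolding classical_solution_def C2_torus_def
  by (auto simp: algebra_simps)

text \<open>
  The barrier has to be a strict supersolution only at the points where it lies below
  \<open>u = exp (- w / \<epsilon>)\<close>; there \<open>w\<close> is bounded above, and this is how the energy \<open>\<epsilon>\<^sup>\<alpha> w\<close> is kept under control
  in the applications.  The sign of \<open>V - \<epsilon>\<^sup>\<alpha> w\<close> is arbitrary, so the maximum principle is applied to the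
  quotient \<open>u / U\<close> and not to the difference.
\<close>

lemma barrier_comparison:
  fixes w :: "real ^ 'n \<Rightarrow> real" and A :: "real ^ 'n ^ 'n"
  assumes sol: "classical_solution \<alpha> \<epsilon> V w" and eps: "0 < \<epsilon>"
    and A: "transpose A = A" and S: "compact S" and N: "0 < N" and B: "0 \<le> B"
    and strict: "\<And>x. x \<in> S \<Longrightarrow> N * gauss \<epsilon> a A (x - z) + B < exp (- w x / \<epsilon>) \<Longrightarrow>
       x \<in> interior S \<and>
       N * gauss \<epsilon> a A (x - z) * (a\<^sup>2 * (norm (A *v (x - z)))\<^sup>2 - a * \<epsilon> * trace A)
         < (N * gauss \<epsilon> a A (x - z) + B) * (V x - \<epsilon> powr \<alpha> * w x)"
    and x: "x \<in> S"
  shows "exp (- w x / \<epsilon>) \<le> N * gauss \<epsilon> a A (x - z) + B"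
proof -
  define U where "U x = N * gauss \<epsilon> a A (x - z) + B" for x
  define u where "u x = exp (- w x / \<epsilon>)" for x
  have U: "U x > 0" for x using N B gauss_pos[of \<epsilon> a A "x - z"] by (simp add: U_def add_pos_nonneg)
  have "continuous_on S (\<lambda>x. u x / U x)"
  proof (intro continuous_on_divide)
    show "continuous_on S u" unfolding u_def
      using eps by (intro continuous_intros C2_continuous classical_solutionD(1)[OF sol]) auto
    show "continuous_on S U" unfolding U_def by (intro continuous_intros)
    show "\<forall>x\<in>S. U x \<noteq> 0" using U by (metis less_irrefl)
  qed
  then obtain p where p: "p \<in> S" "\<And>y. y \<in> S \<Longrightarrow> u y / U y \<le> u p / U p"
    using continuous_attains_sup[OF S] x by blast
  define l where "l = u p / U p"
  have up: "u p = l * U p" using U[of p] by (simp add: l_def)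
  have le: "u y \<le> l * U y" if "y \<in> S" for y
    using p(2)[OF that] U[of y] by (simp add: l_def pos_divide_le_eq)
  have l0: "l > 0" using U[of p] by (simp add: l_def u_def)
  have "l \<le> 1"
  proof (rule ccontr)
    assume l: "\<not> l \<le> 1"
    then have "U p < u p" using up U[of p] by simp
    with strict[OF p(1)] have int: "p \<in> interior S"
      and str: "N * gauss \<epsilon> a A (p - z) * (a\<^sup>2 * (norm (A *v (p - z)))\<^sup>2 - a * \<epsilon> * trace A)
         < U p * (V p - \<epsilon> powr \<alpha> * w p)" by (auto simp: U_def u_def)
    have "eventually (\<lambda>y. y \<in> S) (nhds p)"
      using int by (metis eventually_nhds interior_subset open_interior subsetD)
    then have "eventually (\<lambda>y. y \<in> S) (at p)" by (simp add: eventually_at_filter eventually_mono)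
    then have "eventually (\<lambda>y. (l * N) * gauss \<epsilon> a A (p - z) + l * B - 1 * exp (- w p / \<epsilon>)
                  \<le> (l * N) * gauss \<epsilon> a A (y - z) + l * B - 1 * exp (- w y / \<epsilon>)) (at p)"
    proof eventually_elim
      case (elim y)
      from le[OF elim] up show ?case by (simp add: U_def u_def algebra_simps)
    qed
    from barrier_touching[OF A classical_solutionD(1)[OF sol] eps this]
    have "u p * (V p - \<epsilon> powr \<alpha> * w p)
       \<le> l * (N * gauss \<epsilon> a A (p - z) * (a\<^sup>2 * (norm (A *v (p - z)))\<^sup>2 - a * \<epsilon> * trace A))"
      unfolding classical_solutionD(3)[OF sol] by (simp add: u_def mult.assoc)
    also have "\<dots> < l * (U p * (V p - \<epsilon> powr \<alpha> * w p))"
      using str l0 by simp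
    finally show False by (simp add: up)
  qed
  then have "l * U x \<le> U x" using U[of x] by simp
  then show ?thesis using le[OF x] by (simp add: U_def u_def)
qed

text \<open>
  The region \<open>\<bar>A y\<bar>\<^sup>2 \<le> \<epsilon> K\<close>, in which the potential does not exceed the energy, has radius of order
  \<open>sqrt \<epsilon>\<close>, and on this scale the Gaussian is bounded below independently of \<open>\<epsilon>\<close>.
\<close>

lemma gauss_ge_of_small_image:
  fixes A :: "real ^ 'n ^ 'n"
  assumes mu: "\<mu> > 0" "\<mu> * norm y \<le> norm (A *v y)" and a: "0 \<le> a" and eps: "0 < \<epsilon>"
    and small: "(norm (A *v y))\<^sup>2 \<le> \<epsilon> * K"
  shows "exp (- (a * K / (2 * \<mu>))) \<le> gauss \<epsilon> a A y"
proof -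
  have "y \<bullet> (A *v y) \<le> norm y * norm (A *v y)" by (rule norm_cauchy_schwarz)
  also have "\<dots> \<le> (norm (A *v y) / \<mu>) * norm (A *v y)"
    using mu by (intro mult_right_mono) (auto simp: field_simps)
  also have "\<dots> \<le> \<epsilon> * K / \<mu>" using small mu(1) by (simp add: power2_eq_square divide_right_mono)
  finally have "a * (y \<bullet> (A *v y)) \<le> a * (\<epsilon> * K / \<mu>)" using a by (rule mult_left_mono)
  then have "a * (y \<bullet> (A *v y)) / (2 * \<epsilon>) \<le> a * (\<epsilon> * K / \<mu>) / (2 * \<epsilon>)"
    using eps by (intro divide_right_mono) auto
  also have "\<dots> = a * K / (2 * \<mu>)" using eps by simp
  finally show ?thesis by (simp add: gauss_def)
qed

lemma gauss_le_1:
  assumes "pos_def A" "0 \<le> a" "0 < \<epsilon>"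
  shows "gauss \<epsilon> a A y \<le> 1"
proof -
  have "0 \<le> y \<bullet> (A *v y)"
    using assms(1) by (cases "y = 0") (auto simp: pos_def_def intro: less_imp_le)
  then show ?thesis using assms by (simp add: gauss_def)
qed

lemma compact_eventually_ball:
  fixes K :: "'a::metric_space set"
  assumes K: "compact K" and loc: "\<And>y. y \<in> K \<Longrightarrow> \<exists>d>0. eventually (\<lambda>\<epsilon>. \<forall>p\<in>ball y d. P \<epsilon> p) F"
  shows "eventually (\<lambda>\<epsilon>. \<forall>p\<in>K. P \<epsilon> p) F"
proof -
  obtain d where d: "\<And>y. y \<in> K \<Longrightarrow> d y > 0 \<and> eventually (\<lambda>\<epsilon>. \<forall>p\<in>ball y (d y). P \<epsilon> p) F"
    using loc by metis
  have "K \<subseteq> (\<Union>y\<in>K. ball y (d y))" using d by force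
  then obtain K' where K': "K' \<subseteq> K" "finite K'" "K \<subseteq> (\<Union>y\<in>K'. ball y (d y))"
    by (rule compactE_image[OF K open_ball])
  have "eventually (\<lambda>\<epsilon>. \<forall>y\<in>K'. \<forall>p\<in>ball y (d y). P \<epsilon> p) F"
    using K' d by (intro eventually_ball_finite) auto
  then show ?thesis by eventually_elim (use K'(3) in blast)
qed

section \<open>Energy and decay estimates\<close>

text \<open>
  In the application \<open>c \<epsilon>\<close> is the minimum of \<open>w \<epsilon>\<close>, and \<open>\<epsilon> powr \<beta>\<close> is the height by which \<open>w \<epsilon>\<close>
  exceeds it, up to \<open>O(\<epsilon>)\<close>, away from the selected well.
\<close>

locale vanishing_viscosity =
  fixes V :: "real ^ 'n \<Rightarrow> real" and w :: "real \<Rightarrow> real ^ 'n \<Rightarrow> real" and c :: "real \<Rightarrow> real"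
    and \<alpha> \<beta> :: real
  assumes V_C2: "C2 V" and V_nonneg: "\<And>y. 0 \<le> V y"
    and alpha: "0 < \<alpha>" and beta: "0 < \<beta>" "\<beta> < 1" "1 < \<alpha> + \<beta>"
    and sol: "\<And>\<epsilon>. 0 < \<epsilon> \<Longrightarrow> \<epsilon> < 1 \<Longrightarrow> classical_solution \<alpha> \<epsilon> V (w \<epsilon>)"
    and c_le: "\<And>\<epsilon> y. 0 < \<epsilon> \<Longrightarrow> \<epsilon> < 1 \<Longrightarrow> c \<epsilon> \<le> w \<epsilon> y"
begin

lemma eventually_eps: "eventually (\<lambda>\<epsilon>::real. 0 < \<epsilon> \<and> \<epsilon> < 1) (at_right 0)"
  by (auto simp: eventually_at_right_field intro: exI[of _ 1])

text \<open>
  If the energy \<open>\<epsilon>\<^sup>\<alpha> w\<close> exceeded \<open>\<epsilon> k\<close> everywhere, then \<open>u = exp (- w / \<epsilon>)\<close> would be a positive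
  supersolution, at energy \<open>\<epsilon> k\<close>, on a ball around \<open>z\<close>.  The Gaussian with \<open>a > 1\<close>, lowered by a constant \<open>B\<close> so
  as to be nonpositive on the boundary sphere, is for small \<open>\<epsilon>\<close> a strict subsolution where it is positive: narrowing costs
  only a factor \<open>a\<close> in the ground energy and outweighs the error in the potential.  At an
  interior maximum of the quotient of the two these properties contradict each other.
\<close>

lemma energy_upper_bound:
  assumes zero: "V z = 0" and A: "pos_def A" "A ** A = (1/2) *\<^sub>R hessian V z"
    and k: "0 < trace A" "trace A < k"
  shows "eventually (\<lambda>\<epsilon>. \<epsilon> powr \<alpha> * c \<epsilon> \<le> \<epsilon> * k) (at_right 0)"
proof -
  \<comment> \<open>With this choice the energy of the narrowed Gaussian lies halfway between \<open>trace A\<close> and \<open>k\<close>.\<close>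
  define a where "a = (1 + k / trace A) / 2"
  have a: "1 < a" "a * trace A = (trace A + k) / 2" using k by (auto simp: a_def field_simps)
  have a2: "1 < a\<^sup>2" using a(1) by (simp add: one_less_power)
  obtain d where d: "d > 0" and
    bd: "\<And>y. norm y \<le> d \<Longrightarrow> 1/2 * (norm (A *v y))\<^sup>2 \<le> V (z + y) \<and> V (z + y) \<le> a\<^sup>2 * (norm (A *v y))\<^sup>2"
    using nondegenerate_zero_bounds[OF V_C2 V_nonneg zero A, of "1/2" "a\<^sup>2"] a2 by auto
  obtain \<mu> where mu: "\<mu> > 0" "\<And>v. \<mu> * (norm v)\<^sup>2 \<le> v \<bullet> (A *v v)" "\<And>v. \<mu> * norm v \<le> norm (A *v v)"
    using bounded_below_pos_def[OF A(1)] by metis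
  have tA: "transpose A = A" using A(1) by (simp add: pos_def_def)
  \<comment> \<open>The Gaussian is at most \<open>exp (- t / \<epsilon>)\<close> on the sphere of radius \<open>d\<close>.\<close>
  define t where "t = a * (\<mu> * d\<^sup>2) / 2"
  have t: "t > 0" using a mu d by (simp add: t_def)
  define K where "K = a * (2 * k) / (2 * \<mu>)"
  have "((\<lambda>\<epsilon>. exp (K - t / \<epsilon>) * k) \<longlongrightarrow> 0) (at_right 0)"
    using t by real_asymp
  then have "eventually (\<lambda>\<epsilon>. exp (K - t / \<epsilon>) * k < (k - trace A) / 2) (at_right 0)"
    using k by (intro order_tendstoD) auto
  then show ?thesis using eventually_eps
  proof eventually_elim
    case (elim \<epsilon>)
    then have eps: "0 < \<epsilon>" "\<epsilon> < 1" and eta: "exp (K - t / \<epsilon>) * k < (k - trace A) / 2" by auto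
    note s = sol[OF eps]
    show ?case
    proof (rule ccontr)
      assume "\<not> ?case"
      then have big: "\<epsilon> * k < \<epsilon> powr \<alpha> * w \<epsilon> y" for y
        using mult_left_mono[OF c_le[OF eps, of y], of "\<epsilon> powr \<alpha>"] by force
      define B where "B = exp (- t / \<epsilon>)"
      define G where "G x = gauss \<epsilon> a A (x - z)" for x
      define u where "u x = exp (- w \<epsilon> x / \<epsilon>)" for x
      have u0: "u x > 0" for x by (simp add: u_def)
      have "continuous_on (cball z d) (\<lambda>x. (G x - B) / u x)"
      proof (intro continuous_on_divide continuous_on_diff continuous_on_const)
        show "continuous_on (cball z d) G" unfolding G_def by (intro continuous_intros)
        show "continuous_on (cball z d) u" unfolding u_def
          using eps by (intro continuous_intros C2_continuous classical_solutionD(1)[OF s]) auto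
        show "\<forall>x\<in>cball z d. u x \<noteq> 0" using u0 by (metis less_irrefl)
      qed
      then obtain p where p: "p \<in> cball z d" "\<And>y. y \<in> cball z d \<Longrightarrow> (G y - B) / u y \<le> (G p - B) / u p"
        using continuous_attains_sup[OF compact_cball, of z d "\<lambda>x. (G x - B) / u x"] d by auto
      define l where "l = (G p - B) / u p"
      have up: "l * u p = G p - B" using u0[of p] by (simp add: l_def)
      have le: "G y - B \<le> l * u y" if "y \<in> cball z d" for y
        using p(2)[OF that] u0[of y] by (simp add: l_def pos_divide_le_eq)
      have "0 < G z - B" using t eps by (simp add: G_def gauss_def B_def)
      also have "\<dots> \<le> l * u z" using le[of z] d by simp
      finally have "l > 0" using u0[of z] by (simp add: zero_less_mult_iff)
      then have g: "0 < G p - B" using up u0[of p] by (metis mult_pos_pos)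
      define y where "y = p - z"
      have pz: "p = z + y" by (simp add: y_def)
      have yd: "norm y \<le> d" using p(1) by (simp add: y_def dist_norm norm_minus_commute)
      have "norm y < d"
      proof (rule ccontr)
        assume "\<not> norm y < d"
        then have "a * (\<mu> * d\<^sup>2) \<le> a * (y \<bullet> (A *v y))"
          using yd mu(2)[of y] a by (intro mult_left_mono) auto
        then have "t / \<epsilon> \<le> a * (y \<bullet> (A *v y)) / (2 * \<epsilon>)"
          using eps by (simp add: t_def field_simps)
        then have "G p \<le> B" by (simp add: G_def gauss_def B_def y_def)
        with g show False by simp
      qed
      then have "p \<in> ball z d" by (simp add: y_def dist_norm norm_minus_commute)
      then have "eventually (\<lambda>x. x \<in> ball z d) (nhds p)"
        by (intro eventually_nhds_in_open) auto
      then have "eventually (\<lambda>x. x \<in> cball z d) (at p)"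
        by (auto simp: eventually_at_filter elim!: eventually_mono)
      then have "eventually (\<lambda>x. (-1) * gauss \<epsilon> a A (p - z) + B - (-l) * exp (- w \<epsilon> p / \<epsilon>)
                  \<le> (-1) * gauss \<epsilon> a A (x - z) + B - (-l) * exp (- w \<epsilon> x / \<epsilon>)) (at p)"
      proof eventually_elim
        case (elim x)
        from le[OF elim] up show ?case by (simp add: G_def u_def)
      qed
      from barrier_touching[OF tA classical_solutionD(1)[OF s] eps(1) this]
      have "G p * (a\<^sup>2 * (norm (A *v y))\<^sup>2 - a * \<epsilon> * trace A) \<le> l * u p * (V p - \<epsilon> powr \<alpha> * w \<epsilon> p)"
        unfolding classical_solutionD(3)[OF s] by (simp add: G_def u_def y_def)
      also have "\<dots> \<le> (G p - B) * (V p - \<epsilon> * k)"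
        unfolding up using g big[of p] by (intro mult_left_mono) auto
      finally have main: "G p * (a\<^sup>2 * (norm (A *v y))\<^sup>2 - a * \<epsilon> * trace A) \<le> (G p - B) * (V p - \<epsilon> * k)" .
      have Gp: "0 < G p" by (simp add: G_def gauss_pos)
      have Vu: "V p \<le> a\<^sup>2 * (norm (A *v y))\<^sup>2" and Vl: "(norm (A *v y))\<^sup>2 \<le> 2 * V p"
        using bd[OF yd] by (auto simp: pz)
      have "G p * (V p - a * \<epsilon> * trace A) \<le> (G p - B) * (V p - \<epsilon> * k)"
        using main Vu Gp by (smt (verit) mult_left_mono)
      then have m2: "G p * (\<epsilon> * (k - a * trace A)) \<le> B * (\<epsilon> * k - V p)"
        by (simp add: algebra_simps)
      have ka: "k - a * trace A = (k - trace A) / 2" by (simp add: a(2) field_simps)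
      have lhs: "0 < G p * (\<epsilon> * (k - a * trace A))" using Gp eps k by (simp add: ka)
      \<comment> \<open>The subtracted constant can hurt only where \<open>V < \<epsilon> k\<close>, and there it is exponentially small
          compared with the Gaussian.\<close>
      then have "V p < \<epsilon> * k" using m2 by (smt (verit) B_def exp_gt_zero mult_nonneg_nonpos)
      then have "(norm (A *v y))\<^sup>2 \<le> \<epsilon> * (2 * k)" using Vl by simp
      from gauss_ge_of_small_image[OF mu(1) mu(3) _ eps(1) this, of a]
      have "exp (- K) \<le> G p" using a(1) by (simp add: K_def G_def y_def)
      then have "exp (- K) * (\<epsilon> * (k - a * trace A)) \<le> G p * (\<epsilon> * (k - a * trace A))"
        using eps k by (intro mult_right_mono) (auto simp: ka)
      also have "\<dots> \<le> B * (\<epsilon> * k)"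
        using m2 V_nonneg[of p] by (smt (verit) B_def exp_gt_zero mult_left_mono)
      finally have "exp (- K) * (k - a * trace A) \<le> B * k" using eps by (simp add: mult.left_commute)
      then have "exp K * (exp (- K) * (k - a * trace A)) \<le> exp K * (B * k)" by simp
      moreover have "exp K * (exp (- K) * (k - a * trace A)) = k - a * trace A"
        by (simp add: mult.assoc[symmetric] exp_add[symmetric])
      moreover have "exp K * (B * k) = exp (K - t / \<epsilon>) * k"
        by (simp add: B_def exp_diff exp_minus field_simps)
      ultimately have "k - a * trace A \<le> exp (K - t / \<epsilon>) * k" by linarith
      with eta ka show False by simp
    qed
  qed
qed

text \<open>
  The barrier \<open>exp (- (c + 4 h - 4 h \<bar>x - y\<bar>\<^sup>2 / r\<^sup>2) / \<epsilon>)\<close> reaches the maximal value \<open>exp (- c / \<epsilon>)\<close> on the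
  sphere of radius \<open>r\<close>.  Where it is exceeded by \<open>exp (- w / \<epsilon>)\<close>, the energy is at most
  \<open>\<epsilon>\<^sup>\<alpha> (c + 4 h)\<close>, and with the derivatives of the barrier this tends to 0, while \<open>V\<close> stays away from 0.
\<close>

lemma positive_potential_bound:
  assumes bound: "eventually (\<lambda>\<epsilon>. \<epsilon> powr \<alpha> * c \<epsilon> \<le> \<epsilon> * k) (at_right 0)" and y: "0 < V y"
  shows "\<exists>d>0. eventually (\<lambda>\<epsilon>. \<forall>p\<in>ball y d. c \<epsilon> + 3 * \<epsilon> powr \<beta> \<le> w \<epsilon> p) (at_right 0)"
proof -
  have "isCont V y" using C2_continuous[OF V_C2, of UNIV] by (simp add: continuous_on_eq_continuous_at)
  then have "eventually (\<lambda>x. V y / 2 < V x) (nhds y)"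
    using y unfolding isCont_def tendsto_at_iff_tendsto_nhds by (intro order_tendstoD) auto
  then obtain r0 where r0: "r0 > 0" "\<And>x. dist x y < r0 \<Longrightarrow> V y / 2 < V x"
    by (auto simp: eventually_nhds_metric)
  define r where "r = r0 / 2"
  have r: "r > 0" "\<And>x. dist x y \<le> r \<Longrightarrow> V y / 2 < V x" using r0 by (auto simp: r_def)
  define n where "n = trace (mat 1 :: real ^ 'n ^ 'n)"
  have "((\<lambda>\<epsilon>. 64 * (\<epsilon> powr \<beta>)\<^sup>2 / r\<^sup>2 + 8 * \<epsilon> powr \<beta> / r\<^sup>2 * \<epsilon> * n + (\<epsilon> * k + \<epsilon> powr \<alpha> * (4 * \<epsilon> powr \<beta>))) \<longlongrightarrow> 0) (at_right 0)"
  proof -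
    have "((\<lambda>\<epsilon>::real. \<epsilon> powr \<beta>) \<longlongrightarrow> 0) (at_right 0)" "((\<lambda>\<epsilon>::real. \<epsilon> powr \<alpha>) \<longlongrightarrow> 0) (at_right 0)"
      using alpha beta by real_asymp+
    moreover have "((\<lambda>\<epsilon>. 64 * (f \<epsilon>)\<^sup>2 / r\<^sup>2 + 8 * f \<epsilon> / r\<^sup>2 * \<epsilon> * n + (\<epsilon> * k + g \<epsilon> * (4 * f \<epsilon>))) \<longlongrightarrow> 0) (at_right 0)"
      if "(f \<longlongrightarrow> 0) (at_right 0)" "(g \<longlongrightarrow> 0) (at_right 0)" for f g :: "real \<Rightarrow> real"
      using that r(1) by (auto intro!: tendsto_eq_intros)
    ultimately show ?thesis by blast
  qed
  then have "eventually (\<lambda>\<epsilon>. 64 * (\<epsilon> powr \<beta>)\<^sup>2 / r\<^sup>2 + 8 * \<epsilon> powr \<beta> / r\<^sup>2 * \<epsilon> * n + (\<epsilon> * k + \<epsilon> powr \<alpha> * (4 * \<epsilon> powr \<beta>)) < V y / 2) (at_right 0)"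
    using y by (intro order_tendstoD) auto
  then have "eventually (\<lambda>\<epsilon>. \<forall>p\<in>ball y (r/2). c \<epsilon> + 3 * \<epsilon> powr \<beta> \<le> w \<epsilon> p) (at_right 0)"
    using bound eventually_eps
  proof eventually_elim
    case (elim \<epsilon>)
    then have eps: "0 < \<epsilon>" "\<epsilon> < 1" by auto
    note s = sol[OF eps]
    define h where "h = \<epsilon> powr \<beta>"
    have h: "h > 0" using eps by (simp add: h_def)
    \<comment> \<open>A negative \<open>a\<close> makes the barrier increase with the distance from the centre.\<close>
    define a where "a = - 8 * h / r\<^sup>2"
    define N where "N = exp (- (c \<epsilon> + 4 * h) / \<epsilon>)"
    have N: "N > 0" by (simp add: N_def)
    have U: "N * gauss \<epsilon> a (mat 1) (x - y) = exp (- (c \<epsilon> + 4 * h - 4 * h * (norm (x - y))\<^sup>2 / r\<^sup>2) / \<epsilon>)" for x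
      using eps r by (simp add: N_def gauss_def a_def exp_add[symmetric] power2_norm_eq_inner field_simps)
    have comp: "exp (- w \<epsilon> x / \<epsilon>) \<le> N * gauss \<epsilon> a (mat 1) (x - y) + 0" if "x \<in> cball y r" for x
    proof (rule barrier_comparison[OF s eps(1) _ compact_cball N order_refl _ that])
      show "transpose (mat 1 :: real ^ 'n ^ 'n) = mat 1" by (rule transpose_mat)
      fix x assume x: "x \<in> cball y r"
        and lt: "N * gauss \<epsilon> a (mat 1) (x - y) + 0 < exp (- w \<epsilon> x / \<epsilon>)"
      define q where "q = (norm (x - y))\<^sup>2 / r\<^sup>2"
      have nx: "norm (x - y) \<le> r" using x by (simp add: dist_norm norm_minus_commute)
      have q: "0 \<le> q" "q \<le> 1" using r nx by (simp_all add: q_def power_mono)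
      have wlt: "w \<epsilon> x < c \<epsilon> + 4 * h - 4 * h * q"
      proof -
        have "- (c \<epsilon> + 4 * h - 4 * h * (norm (x - y))\<^sup>2 / r\<^sup>2) / \<epsilon> < - w \<epsilon> x / \<epsilon>"
          using lt unfolding U by (simp only: add_0_right exp_less_cancel_iff)
        then show ?thesis by (subst (asm) divide_less_cancel) (use eps in \<open>auto simp: q_def\<close>)
      qed
      have "norm (x - y) \<noteq> r"
      proof
        assume "norm (x - y) = r"
        then have "q = 1" using r by (simp add: q_def)
        with wlt c_le[OF eps, of x] show False by simp
      qed
      with nx have int: "x \<in> interior (cball y r)" by (simp add: dist_norm norm_minus_commute)
      have "w \<epsilon> x \<le> c \<epsilon> + 4 * h" using wlt q h by (smt (verit) mult_nonneg_nonneg)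
      then have "\<epsilon> powr \<alpha> * w \<epsilon> x \<le> \<epsilon> powr \<alpha> * (c \<epsilon> + 4 * h)" by (intro mult_left_mono) auto
      then have e1: "\<epsilon> powr \<alpha> * w \<epsilon> x \<le> \<epsilon> * k + \<epsilon> powr \<alpha> * (4 * h)"
        using elim by (simp add: distrib_left)
      have "a\<^sup>2 * (norm (x - y))\<^sup>2 = 64 * h\<^sup>2 / r\<^sup>2 * q"
        by (simp add: a_def q_def power2_eq_square field_simps)
      also have "\<dots> \<le> 64 * h\<^sup>2 / r\<^sup>2" using q by (intro mult_left_le) auto
      finally have e2: "a\<^sup>2 * (norm (x - y))\<^sup>2 - a * \<epsilon> * n \<le> 64 * h\<^sup>2 / r\<^sup>2 + 8 * h / r\<^sup>2 * \<epsilon> * n"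
        by (simp add: a_def)
      have "V y / 2 < V x" using r(2)[of x] x by (simp add: dist_commute)
      with e1 e2 elim(1) have "a\<^sup>2 * (norm (x - y))\<^sup>2 - a * \<epsilon> * n < V x - \<epsilon> powr \<alpha> * w \<epsilon> x"
        unfolding h_def[symmetric] by linarith
      with int N gauss_pos[of \<epsilon> a "mat 1" "x - y"]
      show "x \<in> interior (cball y r) \<and>
        N * gauss \<epsilon> a (mat 1) (x - y) * (a\<^sup>2 * (norm (mat 1 *v (x - y)))\<^sup>2 - a * \<epsilon> * trace (mat 1 :: real ^ 'n ^ 'n))
         < (N * gauss \<epsilon> a (mat 1) (x - y) + 0) * (V x - \<epsilon> powr \<alpha> * w \<epsilon> x)"
        by (simp add: n_def mult_strict_left_mono)
    qed
    show ?case
    proof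
      fix p assume "p \<in> ball y (r/2)"
      then have np: "norm (p - y) \<le> r / 2" by (simp add: dist_norm norm_minus_commute)
      then have "(norm (p - y))\<^sup>2 \<le> (r/2)\<^sup>2" by (intro power_mono) auto
      then have "(norm (p - y))\<^sup>2 / r\<^sup>2 \<le> (r/2)\<^sup>2 / r\<^sup>2" by (rule divide_right_mono) simp
      also have "\<dots> = 1 / 4" using r by (simp add: power_divide)
      finally have "(norm (p - y))\<^sup>2 / r\<^sup>2 \<le> 1 / 4" .
      from this h have q: "4 * h * ((norm (p - y))\<^sup>2 / r\<^sup>2) \<le> 4 * h * (1/4)"
        by (intro mult_left_mono) auto
      have "p \<in> cball y r" using np r by (simp add: dist_norm norm_minus_commute)
      from comp[OF this] have "- w \<epsilon> p / \<epsilon> \<le> - (c \<epsilon> + 4 * h - 4 * h * (norm (p - y))\<^sup>2 / r\<^sup>2) / \<epsilon>"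
        unfolding U by (simp only: add_0_right exp_le_cancel_iff)
      then have "c \<epsilon> + 4 * h - 4 * h * (norm (p - y))\<^sup>2 / r\<^sup>2 \<le> w \<epsilon> p"
        by (subst (asm) divide_le_cancel) (use eps in auto)
      with q show "c \<epsilon> + 3 * \<epsilon> powr \<beta> \<le> w \<epsilon> p" by (simp add: h_def)
    qed
  qed
  then show ?thesis using r(1) by (intro exI[of _ "r/2"]) auto
qed

text \<open>
  The barrier is a widened Gaussian (\<open>b < 1\<close>) of height \<open>exp (- (c + h) / \<epsilon>)\<close>, raised by the constant
  \<open>B = exp (- (c + 3 h) / \<epsilon>)\<close>, which dominates \<open>u\<close> on the boundary sphere because \<open>V > 0\<close> there.  Where
  \<open>u\<close> exceeds the barrier, \<open>w < c + 3 h\<close>, so the energy is at most \<open>\<epsilon> k1\<close> with \<open>k1\<close> below \<open>b tr A\<close>,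
  and the barrier is a strict supersolution at this energy.
\<close>

lemma high_energy_well_bound:
  assumes bound: "eventually (\<lambda>\<epsilon>. \<epsilon> powr \<alpha> * c \<epsilon> \<le> \<epsilon> * k0) (at_right 0)"
    and zero: "V z = 0" and A: "pos_def A" "A ** A = (1/2) *\<^sub>R hessian V z"
    and k: "0 < k0" "k0 < trace A"
  shows "\<exists>d>0. eventually (\<lambda>\<epsilon>. \<forall>p\<in>ball z d.
           exp (- w \<epsilon> p / \<epsilon>) \<le> 2 * exp (- (c \<epsilon> + \<epsilon> powr \<beta>) / \<epsilon>)) (at_right 0)"
proof -
  \<comment> \<open>Room between \<open>k0\<close> and \<open>k1\<close> pays for the energy \<open>3 \<epsilon>\<^sup>\<alpha> h\<close>, room between \<open>k1\<close> and \<open>trace A\<close> for widening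
      the Gaussian and for the constant \<open>B\<close>.\<close>
  define k1 where "k1 = (k0 + trace A) / 2"
  have k1: "k0 < k1" "k1 < trace A" using k by (auto simp: k1_def)
  define b where "b = (1 + k1 / trace A) / 2"
  have b: "0 < b" "b < 1" "b * trace A = (trace A + k1) / 2" using k k1 by (auto simp: b_def field_simps)
  have b2: "b\<^sup>2 < 1" "0 < b\<^sup>2" using b by (auto simp: power_less_one_iff)
  obtain d where d: "d > 0" and bd: "\<And>y. norm y \<le> d \<Longrightarrow> b\<^sup>2 * (norm (A *v y))\<^sup>2 \<le> V (z + y)"
    using nondegenerate_zero_bounds[OF V_C2 V_nonneg zero A, of "b\<^sup>2" 2] b2 by auto
  obtain \<mu> where mu: "\<mu> > 0" "\<And>v. \<mu> * norm v \<le> norm (A *v v)"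
    using bounded_below_pos_def[OF A(1)] by metis
  have tA: "transpose A = A" using A(1) by (simp add: pos_def_def)
  define K where "K = b * (k1 / b\<^sup>2) / (2 * \<mu>)"
  have "eventually (\<lambda>\<epsilon>. \<forall>p\<in>sphere z d. c \<epsilon> + 3 * \<epsilon> powr \<beta> \<le> w \<epsilon> p) (at_right 0)"
  proof (rule compact_eventually_ball)
    show "compact (sphere z d)" by simp
    fix y assume y: "y \<in> sphere z d"
    then have n: "norm (y - z) = d" by (simp add: dist_norm norm_minus_commute)
    then have "0 < \<mu> * norm (y - z)" using mu d by simp
    then have "0 < norm (A *v (y - z))" using mu(2)[of "y - z"] by linarith
    then have "0 < b\<^sup>2 * (norm (A *v (y - z)))\<^sup>2" using b2 by simp
    then have "0 < V y" using bd[of "y - z"] n by simp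
    then show "\<exists>d>0. eventually (\<lambda>\<epsilon>. \<forall>p\<in>ball y d. c \<epsilon> + 3 * \<epsilon> powr \<beta> \<le> w \<epsilon> p) (at_right 0)"
      by (rule positive_potential_bound[OF bound])
  qed
  moreover have "eventually (\<lambda>\<epsilon>. 3 * \<epsilon> powr (\<alpha> + \<beta> - 1) < k1 - k0) (at_right 0)"
  proof -
    have "((\<lambda>\<epsilon>. 3 * \<epsilon> powr (\<alpha> + \<beta> - 1)) \<longlongrightarrow> 0) (at_right 0)"
      using beta by real_asymp
    then show ?thesis using k1 by (intro order_tendstoD) auto
  qed
  moreover have "eventually (\<lambda>\<epsilon>. exp (K - 2 * \<epsilon> powr (\<beta> - 1)) * k1 < (trace A - k1) / 2) (at_right 0)"
  proof -
    have "((\<lambda>\<epsilon>. exp (K - 2 * \<epsilon> powr (\<beta> - 1)) * k1) \<longlongrightarrow> 0) (at_right 0)"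
      using beta by real_asymp
    then show ?thesis using k1 by (intro order_tendstoD) auto
  qed
  ultimately have "eventually (\<lambda>\<epsilon>. \<forall>p\<in>ball z d.
           exp (- w \<epsilon> p / \<epsilon>) \<le> 2 * exp (- (c \<epsilon> + \<epsilon> powr \<beta>) / \<epsilon>)) (at_right 0)"
    using bound eventually_eps
  proof eventually_elim
    case (elim \<epsilon>)
    then have eps: "0 < \<epsilon>" "\<epsilon> < 1" by auto
    note s = sol[OF eps]
    define h where "h = \<epsilon> powr \<beta>"
    have h: "h > 0" using eps by (simp add: h_def)
    have he: "\<epsilon> powr (\<beta> - 1) = h / \<epsilon>" and ahe: "\<epsilon> powr (\<alpha> + \<beta> - 1) = \<epsilon> powr \<alpha> * h / \<epsilon>"
      using eps by (simp_all add: h_def powr_diff powr_add)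
    define N where "N = exp (- (c \<epsilon> + h) / \<epsilon>)"
    define B where "B = exp (- (c \<epsilon> + 3 * h) / \<epsilon>)"
    have N: "N > 0" and B: "B > 0" by (auto simp: N_def B_def)
    have BN: "B = N * exp (- 2 * h / \<epsilon>)"
      using eps by (simp add: N_def B_def exp_add[symmetric] field_simps)
    have comp: "exp (- w \<epsilon> x / \<epsilon>) \<le> N * gauss \<epsilon> b A (x - z) + B" if "x \<in> cball z d" for x
    proof (rule barrier_comparison[OF s eps(1) tA compact_cball N less_imp_le[OF B] _ that])
      fix x assume x: "x \<in> cball z d"
        and lt: "N * gauss \<epsilon> b A (x - z) + B < exp (- w \<epsilon> x / \<epsilon>)"
      define y where "y = x - z"
      have xz: "x = z + y" by (simp add: y_def)
      have yd: "norm y \<le> d" using x by (simp add: y_def dist_norm norm_minus_commute)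
      define G where "G = N * gauss \<epsilon> b A y"
      have G: "G > 0" using N by (simp add: G_def gauss_pos)
      have "B < exp (- w \<epsilon> x / \<epsilon>)" using lt G by (simp add: G_def y_def)
      then have "- (c \<epsilon> + 3 * h) / \<epsilon> < - w \<epsilon> x / \<epsilon>" unfolding B_def by (simp only: exp_less_cancel_iff)
      then have wlt: "w \<epsilon> x < c \<epsilon> + 3 * h" by (subst (asm) divide_less_cancel) (use eps in auto)
      have "norm y \<noteq> d"
      proof
        assume "norm y = d"
        then have "x \<in> sphere z d" by (simp add: y_def dist_norm norm_minus_commute)
        then show False using elim(1) wlt by (force simp: h_def)
      qed
      then have int: "x \<in> interior (cball z d)"
        using yd by (simp add: y_def dist_norm norm_minus_commute)
      have "\<epsilon> powr \<alpha> * w \<epsilon> x \<le> \<epsilon> powr \<alpha> * (c \<epsilon> + 3 * h)" using wlt by (intro mult_left_mono) auto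
      also have "\<dots> \<le> \<epsilon> * k0 + \<epsilon> * (3 * (\<epsilon> powr \<alpha> * h / \<epsilon>))"
        using elim eps by (simp add: distrib_left)
      also have "\<dots> \<le> \<epsilon> * k0 + \<epsilon> * (k1 - k0)"
        using elim eps unfolding ahe by (intro add_left_mono mult_left_mono) auto
      finally have wE: "\<epsilon> powr \<alpha> * w \<epsilon> x \<le> \<epsilon> * k1" by (simp add: algebra_simps)
      have Vl: "b\<^sup>2 * (norm (A *v y))\<^sup>2 \<le> V x" using bd[OF yd] by (simp add: xz)
      have gap: "b * trace A - k1 = (trace A - k1) / 2" by (simp add: b(3) field_simps)
      \<comment> \<open>The constant \<open>B\<close> violates the supersolution property only where \<open>V < \<epsilon> k1\<close>; there it is
          smaller than the Gaussian by a factor of order \<open>exp (- 2 h / \<epsilon>)\<close>.\<close>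
      have "B * (\<epsilon> * k1 - V x) < G * (\<epsilon> * (b * trace A - k1))"
      proof (cases "V x < \<epsilon> * k1")
        case False
        then have "B * (\<epsilon> * k1 - V x) \<le> 0" using B by (simp add: mult_nonneg_nonpos)
        also have "0 < G * (\<epsilon> * (b * trace A - k1))" using G eps k1 by (simp add: gap)
        finally show ?thesis .
      next
        case True
        then have "b\<^sup>2 * (norm (A *v y))\<^sup>2 \<le> \<epsilon> * k1" using Vl by simp
        then have "(norm (A *v y))\<^sup>2 \<le> \<epsilon> * (k1 / b\<^sup>2)" using b2 by (simp add: field_simps)
        from gauss_ge_of_small_image[OF mu(1) mu(2) _ eps(1) this, of b]
        have gK: "exp (- K) \<le> gauss \<epsilon> b A y" using b by (simp add: K_def)
        have "B * (\<epsilon> * k1 - V x) \<le> B * (\<epsilon> * k1)" using B V_nonneg[of x] by (intro mult_left_mono) auto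
        also have "\<dots> = N * exp (- K) * \<epsilon> * (exp (K - 2 * (h / \<epsilon>)) * k1)"
          by (simp add: BN exp_diff exp_minus field_simps)
        also have "\<dots> < N * exp (- K) * \<epsilon> * ((trace A - k1) / 2)"
          using elim(3) N eps unfolding he by (intro mult_strict_left_mono) auto
        also have "\<dots> \<le> N * gauss \<epsilon> b A y * \<epsilon> * ((trace A - k1) / 2)"
          using gK N eps k1 by (intro mult_right_mono mult_left_mono) auto
        finally show ?thesis by (simp add: G_def gap mult.assoc)
      qed
      then have "G * (V x - b * \<epsilon> * trace A) < (G + B) * (V x - \<epsilon> * k1)"
        by (simp add: algebra_simps)
      moreover have "G * (b\<^sup>2 * (norm (A *v y))\<^sup>2 - b * \<epsilon> * trace A) \<le> G * (V x - b * \<epsilon> * trace A)"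
        using Vl G by (intro mult_left_mono) auto
      moreover have "(G + B) * (V x - \<epsilon> * k1) \<le> (G + B) * (V x - \<epsilon> powr \<alpha> * w \<epsilon> x)"
        using wE G B by (intro mult_left_mono) auto
      ultimately show "x \<in> interior (cball z d) \<and>
        N * gauss \<epsilon> b A (x - z) * (b\<^sup>2 * (norm (A *v (x - z)))\<^sup>2 - b * \<epsilon> * trace A)
         < (N * gauss \<epsilon> b A (x - z) + B) * (V x - \<epsilon> powr \<alpha> * w \<epsilon> x)"
        using int by (simp add: G_def y_def)
    qed
    show ?case
    proof
      fix p assume "p \<in> ball z d"
      then have "exp (- w \<epsilon> p / \<epsilon>) \<le> N * gauss \<epsilon> b A (p - z) + B" by (intro comp) auto
      also have "\<dots> \<le> N * 1 + N * 1"
      proof (intro add_mono)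
        show "N * gauss \<epsilon> b A (p - z) \<le> N * 1"
          using N b eps gauss_le_1[OF A(1)] by (intro mult_left_mono) auto
        show "B \<le> N * 1" unfolding BN using N h eps by (intro mult_left_mono) auto
      qed
      finally show "exp (- w \<epsilon> p / \<epsilon>) \<le> 2 * exp (- (c \<epsilon> + \<epsilon> powr \<beta>) / \<epsilon>)"
        by (simp add: N_def h_def)
    qed
  qed
  with d show ?thesis by blast
qed

end

section \<open>Periodic functions and the torus\<close>

lemma torus_representative:
  fixes y :: "real ^ 'n"
  obtains k :: "real ^ 'n" where "\<And>i. k $ i \<in> \<int>" "y - k \<in> torus_points"
proof
  show "(\<chi> i. of_int \<lfloor>y $ i\<rfloor>) $ i \<in> \<int>" for i :: 'n by simp
  show "y - (\<chi> i. of_int \<lfloor>y $ i\<rfloor>) \<in> torus_points"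
    by (auto simp: torus_points_def) linarith+
qed

lemma periodic_minus:
  assumes "periodic f" "\<And>i. k $ i \<in> \<int>"
  shows "f (x - k) = f x"
  using assms unfolding periodic_def by (metis diff_add_cancel)

lemma torus_points_subset_cbox: "torus_points \<subseteq> cbox 0 (1 :: real ^ 'n)"
  by (auto simp: torus_points_def mem_box_cart less_imp_le)

lemma periodic_attains_sup:
  fixes f :: "real ^ 'n \<Rightarrow> real"
  assumes per: "periodic f" and cont: "continuous_on UNIV f"
  obtains p where "p \<in> torus_points" "\<And>y. f y \<le> f p"
proof -
  have "0 \<in> cbox 0 (1 :: real ^ 'n)" by (simp add: mem_box_cart)
  then have "cbox 0 (1 :: real ^ 'n) \<noteq> {}" by blast
  then obtain q where q: "\<And>y. y \<in> cbox 0 1 \<Longrightarrow> f y \<le> f q"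
    using continuous_attains_sup[OF compact_cbox _ continuous_on_subset[OF cont subset_UNIV], of 0 1] by blast
  obtain k where k: "\<And>i. k $ i \<in> \<int>" "q - k \<in> torus_points" by (rule torus_representative[of q]) blast
  have "f y \<le> f (q - k)" for y
  proof -
    obtain l where l: "\<And>i. l $ i \<in> \<int>" "y - l \<in> torus_points" by (rule torus_representative[of y]) blast
    then have "f (y - l) \<le> f q" using torus_points_subset_cbox by (intro q) blast
    then show ?thesis using periodic_minus[OF per] k(1) l(1) by metis
  qed
  with k(2) that show ?thesis by blast
qed

lemma periodic_bounded:
  fixes f :: "real ^ 'n \<Rightarrow> real"
  assumes per: "periodic f" and cont: "continuous_on UNIV f"
  obtains B where "B \<ge> 0" "\<And>y. \<bar>f y\<bar> \<le> B"
proof -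
  have "periodic (\<lambda>y. \<bar>f y\<bar>)" using per by (simp add: periodic_def)
  moreover have "continuous_on UNIV (\<lambda>y. \<bar>f y\<bar>)" using cont by (intro continuous_intros)
  ultimately obtain p where "\<And>y. \<bar>f y\<bar> \<le> \<bar>f p\<bar>" by (rule periodic_attains_sup) blast
  with that[of "\<bar>f p\<bar>"] show ?thesis by simp
qed

text \<open>
  The first partial derivatives are again continuous and periodic, hence bounded.
\<close>

lemma C2_torus_one_sided_lipschitz:
  fixes V :: "real ^ 'n \<Rightarrow> real"
  assumes "C2_torus V"
  obtains L where "L \<ge> 0" "\<And>x z. V (x + z) - V x \<le> L * norm z"
proof -
  have V: "C2 V" and per: "periodic V" using assms by (auto simp: C2_torus_def)
  have "\<exists>B. B \<ge> 0 \<and> (\<forall>y. \<bar>partial_deriv i V y\<bar> \<le> B)" for i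
  proof -
    have "periodic (partial_deriv i V)"
      unfolding periodic_def
    proof (intro allI impI)
      fix x k :: "real ^ 'n" assume k: "\<forall>i. k $ i \<in> \<int>"
      have "V ((x + t *\<^sub>R axis i 1) + k) = V (x + t *\<^sub>R axis i 1)" for t
        using per k unfolding periodic_def by blast
      then have "(\<lambda>t. V ((x + k) + t *\<^sub>R axis i 1)) = (\<lambda>t. V (x + t *\<^sub>R axis i 1))"
        by (simp add: add_ac)
      then have "((\<lambda>t. V (x + t *\<^sub>R axis i 1)) has_real_derivative partial_deriv i V (x + k)) (at 0)"
        using C2_line(1)[OF V, of "x + k" i 0] by simp
      moreover have "((\<lambda>t. V (x + t *\<^sub>R axis i 1)) has_real_derivative partial_deriv i V x) (at 0)"
        using C2_line(1)[OF V, of x i 0] by simp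
      ultimately show "partial_deriv i V (x + k) = partial_deriv i V x" by (rule DERIV_unique)
    qed
    moreover have "continuous_on UNIV (partial_deriv i V)"
      using V unfolding C2_def
      by (meson continuous_at_imp_continuous_on differentiable_imp_continuous_within)
    ultimately show ?thesis by (metis periodic_bounded)
  qed
  then obtain B where B: "\<And>i. B i \<ge> 0" "\<And>i y. \<bar>partial_deriv i V y\<bar> \<le> B i" by metis
  have "V (x + z) - V x \<le> (\<Sum>i\<in>UNIV. B i) * norm z" for x z
  proof -
    have diff: "V differentiable (at y)" for y using V by (simp add: C2_def)
    obtain s where s: "V (x + 1 *\<^sub>R z) - V (x + 0 *\<^sub>R z) = (1 - 0) * frechet_derivative V (at (x + s *\<^sub>R z)) z"
      using MVT2[of 0 1 "\<lambda>s. V (x + s *\<^sub>R z)" "\<lambda>s. frechet_derivative V (at (x + s *\<^sub>R z)) z"]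
        derivative_along_line[OF diff] by force
    have "frechet_derivative V (at (x + s *\<^sub>R z)) z = (\<Sum>i\<in>UNIV. partial_deriv i V (x + s *\<^sub>R z) * z $ i)"
      by (simp add: frechet_derivative_eq_gradient[OF diff] gradient_def inner_vec_def)
    also have "\<dots> \<le> (\<Sum>i\<in>UNIV. B i * norm z)"
    proof (rule sum_mono)
      fix i
      have "partial_deriv i V (x + s *\<^sub>R z) * z $ i \<le> \<bar>partial_deriv i V (x + s *\<^sub>R z)\<bar> * \<bar>z $ i\<bar>"
        by (simp add: abs_mult[symmetric])
      also have "\<dots> \<le> B i * norm z" using B by (intro mult_mono component_le_norm_cart) auto
      finally show "partial_deriv i V (x + s *\<^sub>R z) * z $ i \<le> B i * norm z" .
    qed
    finally show ?thesis using s by (simp add: sum_distrib_right)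
  qed
  moreover have "0 \<le> (\<Sum>i\<in>UNIV. B i)" using B by (intro sum_nonneg) auto
  ultimately show ?thesis using that by blast
qed

section \<open>Lower bound for the partition function\<close>

text \<open>
  At a maximum of \<open>w (y + z) - w y\<close> the gradients agree and the Laplacians are ordered, so subtracting
  the equations at the two points leaves only the difference of the potentials.  This bounds the
  oscillation of \<open>w\<close> without differentiating the equation.
\<close>

lemma solution_translation_bound:
  fixes w :: "real ^ 'n \<Rightarrow> real"
  assumes sol: "classical_solution \<alpha> \<epsilon> V w" and eps: "0 < \<epsilon>" and D: "\<And>x. V (x + z) - V x \<le> D"
  shows "\<epsilon> powr \<alpha> * (w (x + z) - w x) \<le> D"
proof -
  note w = classical_solutionD[OF sol]
  have "periodic (\<lambda>y. w (y + z) - w y)"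
    unfolding periodic_def
  proof (intro allI impI)
    fix y k :: "real ^ 'n" assume "\<forall>i. k $ i \<in> \<int>"
    then have "w ((y + z) + k) = w (y + z)" "w (y + k) = w y" using w(2) unfolding periodic_def by blast+
    then show "w (y + k + z) - w (y + k) = w (y + z) - w y" by (simp add: add_ac)
  qed
  moreover have "continuous_on UNIV (\<lambda>y. w (y + z) - w y)"
    by (intro continuous_intros C2_continuous[OF w(1)] continuous_on_compose2[OF C2_continuous[OF w(1), of UNIV]]) auto
  ultimately obtain p where p: "\<And>y. w (y + z) - w y \<le> w (p + z) - w p"
    by (rule periodic_attains_sup) blast
  note t = translation_touching[OF w(1), of z p, OF p]
  have "\<epsilon> * laplacian w (p + z) \<le> \<epsilon> * laplacian w p" using t(2) eps by simp
  then have "\<epsilon> powr \<alpha> * w (p + z) - \<epsilon> powr \<alpha> * w p \<le> V (p + z) - V p"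
    using w(3)[of "p + z"] w(3)[of p] unfolding t(1) by linarith
  then have "\<epsilon> powr \<alpha> * (w (p + z) - w p) \<le> D" using D[of p] by (simp add: right_diff_distrib)
  moreover have "\<epsilon> powr \<alpha> * (w (x + z) - w x) \<le> \<epsilon> powr \<alpha> * (w (p + z) - w p)"
    using p by (intro mult_left_mono) auto
  ultimately show ?thesis by linarith
qed

lemma torus_points_borel [measurable]: "(torus_points :: (real ^ 'n) set) \<in> sets borel"
proof -
  have "torus_points = (\<Inter>i. {x :: real ^ 'n. 0 \<le> x $ i} \<inter> {x. x $ i < 1})"
    by (auto simp: torus_points_def)
  moreover have "{x :: real ^ 'n. 0 \<le> x $ i} \<inter> {x. x $ i < 1} \<in> sets borel" for i
    by (intro sets.Int borel_closed borel_open closed_Collect_le open_Collect_less continuous_intros)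
  ultimately show ?thesis by (metis (no_types, lifting) sets.finite_INT UNIV_not_empty finite)
qed

lemma space_torus_measure [simp]: "space torus_measure = torus_points"
  by (simp add: torus_measure_def space_restrict_space)

lemma measure_torus_measure: "A \<subseteq> torus_points \<Longrightarrow> measure torus_measure A = measure lborel A"
  unfolding torus_measure_def by (rule measure_restrict_space) auto

lemma finite_torus_measure: "finite_measure (torus_measure :: (real ^ 'n) measure)"
  and measure_torus_points_le_1: "measure (torus_measure :: (real ^ 'n) measure) torus_points \<le> 1"
proof -
  have "emeasure torus_measure (torus_points :: (real ^ 'n) set) = emeasure lborel (torus_points :: (real ^ 'n) set)"
    unfolding torus_measure_def by (rule emeasure_restrict_space) auto
  also have "\<dots> \<le> emeasure lborel (cbox 0 (1 :: real ^ 'n))"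
    by (intro emeasure_mono torus_points_subset_cbox) auto
  also have "\<dots> = ennreal (measure lborel (cbox 0 (1 :: real ^ 'n)))"
    by (intro emeasure_eq_ennreal_measure) (simp add: emeasure_lborel_cbox_eq)
  also have "measure lborel (cbox 0 (1 :: real ^ 'n)) = 1"
  proof -
    have "0 \<in> cbox 0 (1 :: real ^ 'n)" by (simp add: mem_box_cart)
    then show ?thesis by (subst content_cbox_cart) auto
  qed
  finally have le: "emeasure torus_measure (torus_points :: (real ^ 'n) set) \<le> 1" by simp
  then show "finite_measure (torus_measure :: (real ^ 'n) measure)"
    by (intro finite_measureI) (auto simp: top_unique)
  show "measure (torus_measure :: (real ^ 'n) measure) torus_points \<le> 1"
    using le by (simp add: measure_def enn2real_leI)
qed

lemma borel_measurable_torus: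
  fixes f :: "real ^ 'n \<Rightarrow> real"
  assumes "continuous_on UNIV f"
  shows "f \<in> borel_measurable torus_measure"
  unfolding torus_measure_def
  using borel_measurable_continuous_onI[OF assms] by (intro measurable_restrict_space1) simp

lemma integrable_torus:
  fixes f :: "real ^ 'n \<Rightarrow> real"
  assumes "continuous_on UNIV f"
  shows "integrable torus_measure f"
proof -
  have "compact (f ` cbox 0 1)"
    by (intro compact_continuous_image continuous_on_subset[OF assms]) auto
  then obtain B where "\<And>y. y \<in> cbox 0 1 \<Longrightarrow> norm (f y) \<le> B"
    by (meson compact_imp_bounded bounded_iff imageI)
  then have "AE y in torus_measure. norm (f y) \<le> B"
    using torus_points_subset_cbox by (intro AE_I2) auto
  then show ?thesis
    using finite_measure.integrable_const_bound[OF finite_torus_measure _ borel_measurable_torus[OF assms]] by blast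
qed

text \<open>
  On a cube with side \<open>\<eta>\<close> and vertex \<open>p\<close> the translation bound gives \<open>w \<le> w p + \<epsilon>\<close>, hence a loss of at most a
  factor \<open>e\<close> in \<open>exp (- w / \<epsilon>)\<close>.  The assumption \<open>4 \<le> L\<close> makes \<open>\<eta> \<le> 1/4\<close>, so that such a cube fits into the
  fundamental domain.
\<close>

lemma partition_function_lower_bound:
  fixes w :: "real ^ 'n \<Rightarrow> real"
  assumes sol: "classical_solution \<alpha> \<epsilon> V w" and eps: "0 < \<epsilon>" "\<epsilon> < 1" and al: "0 < \<alpha>"
    and L: "4 \<le> L" "\<And>x z. V (x + z) - V x \<le> L * norm z" and p: "p \<in> torus_points"
  shows "exp (- w p / \<epsilon> - 1) * (\<epsilon> powr (1 + \<alpha>) / (L * CARD('n))) ^ CARD('n)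
           \<le> (LINT y|torus_measure. exp (- w y / \<epsilon>))"
proof -
  define \<eta> where "\<eta> = \<epsilon> powr (1 + \<alpha>) / (L * CARD('n))"
  have n1: "1 \<le> real CARD('n)" by (simp add: Suc_leI)
  have "4 * 1 \<le> L * real CARD('n)" using L(1) n1 by (intro mult_mono) auto
  moreover have "\<epsilon> powr (1 + \<alpha>) \<le> 1" using eps al by (simp add: powr_le1)
  ultimately have eta: "0 < \<eta>" "\<eta> \<le> 1/4"
    using eps by (auto simp: \<eta>_def field_simps)
  \<comment> \<open>In each coordinate the cube extends from \<open>p\<close> towards the farther face of the unit cube.\<close>
  define a :: "real ^ 'n" where "a = (\<chi> i. if p $ i \<le> 1/2 then p $ i else p $ i - \<eta>)"
  define C where "C = cbox a (a + (\<chi> i. \<eta>))"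
  have CT: "C \<subseteq> torus_points"
  proof
    fix y assume y: "y \<in> C"
    have "0 \<le> y $ i \<and> y $ i < 1" for i
    proof -
      have "a $ i \<le> y $ i" "y $ i \<le> a $ i + \<eta>" using y by (auto simp: C_def mem_box_cart)
      moreover have "0 \<le> p $ i" "p $ i < 1" using p by (auto simp: torus_points_def)
      ultimately show ?thesis using eta by (auto simp: a_def split: if_splits)
    qed
    then show "y \<in> torus_points" by (simp add: torus_points_def)
  qed
  have low: "exp (- w p / \<epsilon> - 1) \<le> exp (- w y / \<epsilon>)" if y: "y \<in> C" for y
  proof -
    have "\<bar>(y - p) $ i\<bar> \<le> \<eta>" for i
    proof -
      have "a $ i \<le> y $ i" "y $ i \<le> a $ i + \<eta>" using y by (auto simp: C_def mem_box_cart)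
      then show ?thesis using eta by (auto simp: a_def split: if_splits)
    qed
    then have "norm (y - p) \<le> (\<Sum>i\<in>(UNIV::'n set). \<eta>)"
      by (intro order_trans[OF norm_le_l1_cart] sum_mono)
    then have "L * norm (y - p) \<le> L * (CARD('n) * \<eta>)" using L(1) by (intro mult_left_mono) auto
    also have "\<dots> = \<epsilon> powr \<alpha> * \<epsilon>" using L(1) eps by (simp add: \<eta>_def powr_add)
    finally have D: "V (x + (y - p)) - V x \<le> \<epsilon> powr \<alpha> * \<epsilon>" for x using L(2)[of x "y - p"] by linarith
    have "\<epsilon> powr \<alpha> * (w y - w p) \<le> \<epsilon> powr \<alpha> * \<epsilon>"
      using solution_translation_bound[OF sol eps(1) D, of p] by simp
    then have "w y - w p \<le> \<epsilon>" using eps by simp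
    then have "- (w p + \<epsilon>) / \<epsilon> \<le> - w y / \<epsilon>" using eps by (intro divide_right_mono) auto
    moreover have "- (w p + \<epsilon>) / \<epsilon> = - w p / \<epsilon> - 1" using eps by (simp add: field_simps)
    ultimately show ?thesis by simp
  qed
  have cont: "continuous_on UNIV (\<lambda>y. exp (- w y / \<epsilon>))"
    using eps by (intro continuous_intros C2_continuous classical_solutionD(1)[OF sol]) auto
  have "measure torus_measure C = \<eta> ^ CARD('n)"
  proof -
    have "a \<in> C" using eta by (simp add: C_def mem_box_cart)
    then have "C \<noteq> {}" by blast
    then show ?thesis
      unfolding measure_torus_measure[OF CT] unfolding C_def
      by (subst content_cbox_cart) auto
  qed
  have Cs: "C \<in> sets torus_measure"
    unfolding torus_measure_def using CT by (subst sets_restrict_space_iff) (auto simp: C_def)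
  interpret finite_measure "torus_measure :: (real ^ 'n) measure" by (rule finite_torus_measure)
  have "exp (- w p / \<epsilon> - 1) * measure torus_measure C = (LINT y|torus_measure. exp (- w p / \<epsilon> - 1) * indicator C y)"
    using CT by (simp add: Int_absorb2)
  also have "\<dots> \<le> (LINT y|torus_measure. exp (- w y / \<epsilon>))"
  proof (rule integral_mono)
    show "integrable torus_measure (\<lambda>y. exp (- w p / \<epsilon> - 1) * indicator C y)"
      using Cs by (intro integrable_mult_right) (simp add: emeasure_finite less_top[symmetric])
    show "integrable torus_measure (\<lambda>y. exp (- w y / \<epsilon>))" by (rule integrable_torus[OF cont])
    show "exp (- w p / \<epsilon> - 1) * indicator C y \<le> exp (- w y / \<epsilon>)" for y
      using low[of y] by (cases "y \<in> C") simp_all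
  qed
  finally show ?thesis using \<open>measure torus_measure C = _\<close> by (simp add: \<eta>_def)
qed

section \<open>Concentration in the selected well\<close>

text \<open>
  A pointwise bound that splits into a small multiple of the density, which has mass 1, and a small
  constant: the former is used near the selected well, the latter away from it.
\<close>

lemma gibbs_average_deviation:
  fixes w \<phi> :: "real ^ 'n \<Rightarrow> real"
  assumes w: "continuous_on UNIV w" and phi: "continuous_on UNIV \<phi>" and eps: "0 < \<epsilon>"
    and e: "0 \<le> e" and bound: "\<And>y. y \<in> torus_points \<Longrightarrow>
       gibbs_density \<epsilon> w y * \<bar>\<phi> y - b\<bar> \<le> e * gibbs_density \<epsilon> w y + s"
    and Z: "0 < (LINT y|torus_measure. exp (- w y / \<epsilon>))" and s: "0 \<le> s"
  shows "\<bar>(LINT y|density torus_measure (\<lambda>y. ennreal (gibbs_density \<epsilon> w y)). \<phi> y) - b\<bar> \<le> e + s"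
proof -
  let ?g = "gibbs_density \<epsilon> w"
  interpret finite_measure "torus_measure :: (real ^ 'n) measure" by (rule finite_torus_measure)
  have g: "continuous_on UNIV ?g"
    unfolding gibbs_density_def using w eps Z by (intro continuous_intros) auto
  have g0: "0 \<le> ?g y" for y using Z by (simp add: gibbs_density_def)
  have ig: "integrable torus_measure (\<lambda>y. f y)" if "continuous_on UNIV f" for f :: "real ^ 'n \<Rightarrow> real"
    using that by (rule integrable_torus)
  have one: "(LINT y|torus_measure. ?g y) = 1"
    using Z by (simp add: gibbs_density_def)
  have "(LINT y|density torus_measure (\<lambda>y. ennreal (?g y)). \<phi> y) = (LINT y|torus_measure. ?g y * \<phi> y)"
    using borel_measurable_torus[OF phi] borel_measurable_torus[OF g] g0
    by (subst integral_density) auto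
  then have "(LINT y|density torus_measure (\<lambda>y. ennreal (?g y)). \<phi> y) - b
      = (LINT y|torus_measure. ?g y * \<phi> y) - (LINT y|torus_measure. ?g y * b)"
    using one by simp
  also have "\<dots> = (LINT y|torus_measure. ?g y * \<phi> y - ?g y * b)"
    by (intro Bochner_Integration.integral_diff[symmetric] ig continuous_intros g phi)
  finally have "\<bar>(LINT y|density torus_measure (\<lambda>y. ennreal (?g y)). \<phi> y) - b\<bar>
      \<le> (LINT y|torus_measure. \<bar>?g y * \<phi> y - ?g y * b\<bar>)"
    by (simp add: integral_abs_bound)
  also have "\<dots> \<le> (LINT y|torus_measure. e * ?g y + s)"
  proof (rule integral_mono)
    show "integrable torus_measure (\<lambda>y. \<bar>?g y * \<phi> y - ?g y * b\<bar>)"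
      by (intro ig continuous_intros g phi)
    show "integrable torus_measure (\<lambda>y. e * ?g y + s)"
      by (intro ig continuous_intros g)
    fix y :: "real ^ 'n" assume "y \<in> space torus_measure"
    then show "\<bar>?g y * \<phi> y - ?g y * b\<bar> \<le> e * ?g y + s"
      using bound[of y] g0[of y] by (simp add: right_diff_distrib[symmetric] abs_mult)
  qed
  also have "\<dots> = e * (LINT y|torus_measure. ?g y) + s * measure torus_measure (torus_points :: (real ^ 'n) set)"
    using ig[OF g] by (simp add: mult.commute)
  also have "\<dots> \<le> e + s"
    using one mult_left_le[OF measure_torus_points_le_1 s] by simp
  finally show ?thesis .
qed

theorem theorem1p5:
  fixes V :: "real ^ 'n \<Rightarrow> real"
    and x :: "nat \<Rightarrow> real ^ 'n"
    and m j :: nat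
    and \<alpha> :: real
    and w :: "real \<Rightarrow> real ^ 'n \<Rightarrow> real"
  assumes "C2_torus V"
    and "\<forall>y. 0 \<le> V y"
    and "1 \<le> m"
    and "inj_on x {1..m}"
    and "{y \<in> torus_points. V y = 0} = x ` {1..m}"
    and "\<forall>i\<in>{1..m}. pos_def (hessian V (x i))"
    and "0 < \<alpha>"
    and "j \<in> {1..m}"
    and "0 < kappa V (x j)"
    and "\<forall>i\<in>{1..m} - {j}. kappa V (x j) < kappa V (x i)"
    and "\<forall>\<epsilon>\<in>{0<..<1}. classical_solution \<alpha> \<epsilon> V (w \<epsilon>)"
  shows "torus_weak_convergence
           (\<lambda>\<epsilon>. density torus_measure (\<lambda>y. ennreal (gibbs_density \<epsilon> (w \<epsilon>) y)))
           (return torus_measure (x j))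
           (at_right 0)"
proof -
  have V: "C2 V" "periodic V" using assms(1) by (auto simp: C2_torus_def)
  have sol: "classical_solution \<alpha> \<epsilon> V (w \<epsilon>)" if "0 < \<epsilon>" "\<epsilon> < 1" for \<epsilon>
    using assms(11) that by auto
  have "\<exists>p. p \<in> torus_points \<and> (\<forall>y. w \<epsilon> p \<le> w \<epsilon> y)" if "0 < \<epsilon>" "\<epsilon> < 1" for \<epsilon>
  proof -
    note w = classical_solutionD[OF sol[OF that]]
    have "periodic (\<lambda>y. - w \<epsilon> y)" using w(2) by (simp add: periodic_def)
    moreover have "continuous_on UNIV (\<lambda>y. - w \<epsilon> y)" by (intro continuous_intros C2_continuous w)
    ultimately obtain p where "p \<in> torus_points" "\<And>y. - w \<epsilon> y \<le> - w \<epsilon> p"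
      by (rule periodic_attains_sup) blast
    then show ?thesis by auto
  qed
  then obtain p where p: "\<And>\<epsilon>. 0 < \<epsilon> \<Longrightarrow> \<epsilon> < 1 \<Longrightarrow> p \<epsilon> \<in> torus_points \<and> (\<forall>y. w \<epsilon> (p \<epsilon>) \<le> w \<epsilon> y)"
    by metis
  define c where "c \<epsilon> = w \<epsilon> (p \<epsilon>)" for \<epsilon>
  \<comment> \<open>Any \<open>\<beta>\<close> strictly between \<open>max 0 (1 - \<alpha>)\<close> and 1 would do.\<close>
  define \<beta> where "\<beta> = 1 - min \<alpha> 1 / 2"
  have beta: "0 < \<beta>" "\<beta> < 1" "1 < \<alpha> + \<beta>" using assms(7) by (auto simp: \<beta>_def min_def)
  interpret vanishing_viscosity V w c \<alpha> \<beta>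
    using V assms(2,7) beta sol p by unfold_locales (auto simp: c_def)
  have zero: "V (x i) = 0" "x i \<in> torus_points" if "i \<in> {1..m}" for i
    using assms(5) that by blast+
  have root: "pos_def (matrix_sqrt ((1/2) *\<^sub>R hessian V (x i)))"
    "matrix_sqrt ((1/2) *\<^sub>R hessian V (x i)) ** matrix_sqrt ((1/2) *\<^sub>R hessian V (x i)) = (1/2) *\<^sub>R hessian V (x i)"
    if "i \<in> {1..m}" for i
  proof -
    have "pos_def ((1/2) *\<^sub>R hessian V (x i))"
      using assms(6) that by (auto simp: pos_def_def scaleR_matrix_vector_assoc[symmetric] transpose_scalar)
    from matrix_sqrt_works[OF this]
    show "pos_def (matrix_sqrt ((1/2) *\<^sub>R hessian V (x i)))"
      "matrix_sqrt ((1/2) *\<^sub>R hessian V (x i)) ** matrix_sqrt ((1/2) *\<^sub>R hessian V (x i)) = (1/2) *\<^sub>R hessian V (x i)" .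
  qed
  obtain k0 where k0: "kappa V (x j) < k0" "\<And>i. i \<in> {1..m} - {j} \<Longrightarrow> k0 < kappa V (x i)"
  proof
    define S where "S = insert (kappa V (x j) + 1) ((\<lambda>i. kappa V (x i)) ` ({1..m} - {j}))"
    have S: "finite S" "S \<noteq> {}" by (auto simp: S_def)
    have M: "kappa V (x j) < Min S" using assms(10) S by (subst Min_gr_iff) (auto simp: S_def)
    then show "kappa V (x j) < (kappa V (x j) + Min S) / 2" by simp
    fix i assume "i \<in> {1..m} - {j}"
    then have "Min S \<le> kappa V (x i)" using S by (intro Min_le) (auto simp: S_def)
    then show "(kappa V (x j) + Min S) / 2 < kappa V (x i)"
      by (rule less_le_trans[rotated]) (use M in simp)
  qed
  have energy: "eventually (\<lambda>\<epsilon>. \<epsilon> powr \<alpha> * c \<epsilon> \<le> \<epsilon> * k0) (at_right 0)"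
    using energy_upper_bound[OF zero(1) root] assms(8,9) k0(1) by (simp add: kappa_def)
  obtain L0 where L0: "\<And>x z. V (x + z) - V x \<le> L0 * norm z"
    by (rule C2_torus_one_sided_lipschitz[OF assms(1)]) blast
  define L where "L = max L0 4"
  have L: "4 \<le> L" "\<And>x z. V (x + z) - V x \<le> L * norm z"
  proof -
    show "V (x + z) - V x \<le> L * norm z" for x z
      using L0[of x z] mult_right_mono[of L0 L "norm z"] by (simp add: L_def)
  qed (simp add: L_def)
  define n where "n = CARD('n)"
  \<comment> \<open>The bound for the Gibbs density away from the selected well: exponentially small height divided
      by the polynomially small lower bound for the normalised partition function.\<close>
  define s where "s \<epsilon> = 2 * exp 1 * (exp (- (\<epsilon> powr (\<beta> - 1))) / \<epsilon> powr ((1 + \<alpha>) * real n)) * (L * real n) ^ n" for \<epsilon>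
  have s_lim: "(s \<longlongrightarrow> 0) (at_right 0)"
  proof -
    have "((\<lambda>\<epsilon>. exp (- (\<epsilon> powr (\<beta> - 1))) / \<epsilon> powr ((1 + \<alpha>) * real n)) \<longlongrightarrow> 0) (at_right 0)"
      using beta assms(7) by real_asymp
    from tendsto_mult_left[OF tendsto_mult_right[OF this], of "2 * exp 1" "(L * real n) ^ n"]
    show ?thesis by (simp add: s_def[abs_def] mult_ac)
  qed
  show ?thesis
    unfolding torus_weak_convergence_def
  proof (intro allI impI, elim conjE)
    fix \<phi> :: "real ^ 'n \<Rightarrow> real"
    assume phi: "continuous_on UNIV \<phi>" "periodic \<phi>"
    have "(LINT y|return torus_measure (x j). \<phi> y) = \<phi> (x j)"
      using zero(2)[OF assms(8)] borel_measurable_torus[OF phi(1)] by (intro integral_return) auto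
    moreover have "((\<lambda>\<epsilon>. LINT y|density torus_measure (\<lambda>y. ennreal (gibbs_density \<epsilon> (w \<epsilon>) y)). \<phi> y)
        \<longlongrightarrow> \<phi> (x j)) (at_right 0)"
    proof (rule tendstoI)
      fix e :: real assume e: "0 < e"
      obtain B where B: "B \<ge> 0" "\<And>y. \<bar>\<phi> y\<bar> \<le> B" using periodic_bounded[OF phi(2,1)] by blast
      have "isCont \<phi> (x j)" using phi(1) by (simp add: continuous_on_eq_continuous_at)
      then obtain \<delta> where delta: "\<delta> > 0" "\<And>y. dist y (x j) < \<delta> \<Longrightarrow> \<bar>\<phi> y - \<phi> (x j)\<bar> < e / 2"
        using e unfolding continuous_at_eps_delta dist_real_def by (meson half_gt_zero)
      \<comment> \<open>All lattice translates of \<open>x j\<close> count, because a neighbourhood of \<open>x j\<close> on the torus may wrap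
          around to the opposite faces of the cube.\<close>
      define K where "K = cbox 0 1 \<inter> (\<Inter>k\<in>{k. \<forall>i. k $ i \<in> \<int>}. {y. \<delta> \<le> dist y (x j + k)})"
      have "compact K" unfolding K_def
        by (intro compact_Int_closed closed_INT ballI closed_Collect_le continuous_intros) auto
      then have "eventually (\<lambda>\<epsilon>. \<forall>y\<in>K. exp (- w \<epsilon> y / \<epsilon>) \<le> 2 * exp (- (c \<epsilon> + \<epsilon> powr \<beta>) / \<epsilon>)) (at_right 0)"
      proof (rule compact_eventually_ball)
        fix y assume y: "y \<in> K"
        show "\<exists>d>0. eventually (\<lambda>\<epsilon>. \<forall>q\<in>ball y d. exp (- w \<epsilon> q / \<epsilon>) \<le> 2 * exp (- (c \<epsilon> + \<epsilon> powr \<beta>) / \<epsilon>)) (at_right 0)"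
        proof (cases "V y = 0")
          case False
          then have "0 < V y" using assms(2) by (simp add: order_less_le)
          from positive_potential_bound[OF energy this] obtain d where d: "d > 0"
            "eventually (\<lambda>\<epsilon>. \<forall>q\<in>ball y d. c \<epsilon> + 3 * \<epsilon> powr \<beta> \<le> w \<epsilon> q) (at_right 0)" by blast
          from d(2) eventually_eps have "eventually (\<lambda>\<epsilon>. \<forall>q\<in>ball y d. exp (- w \<epsilon> q / \<epsilon>) \<le> 2 * exp (- (c \<epsilon> + \<epsilon> powr \<beta>) / \<epsilon>)) (at_right 0)"
          proof eventually_elim
            case (elim \<epsilon>)
            show ?case
            proof
              fix q assume "q \<in> ball y d"
              then have "c \<epsilon> + 3 * \<epsilon> powr \<beta> \<le> w \<epsilon> q" using elim by blast
              then have "c \<epsilon> + \<epsilon> powr \<beta> \<le> w \<epsilon> q" using powr_ge_zero[of \<epsilon> \<beta>] by linarith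
              then have "- w \<epsilon> q / \<epsilon> \<le> - (c \<epsilon> + \<epsilon> powr \<beta>) / \<epsilon>"
                using elim by (intro divide_right_mono) auto
              then have "exp (- w \<epsilon> q / \<epsilon>) \<le> exp (- (c \<epsilon> + \<epsilon> powr \<beta>) / \<epsilon>)"
                by (simp only: exp_le_cancel_iff)
              also have "\<dots> \<le> 2 * exp (- (c \<epsilon> + \<epsilon> powr \<beta>) / \<epsilon>)" by simp
              finally show "exp (- w \<epsilon> q / \<epsilon>) \<le> 2 * exp (- (c \<epsilon> + \<epsilon> powr \<beta>) / \<epsilon>)" .
            qed
          qed
          with d(1) show ?thesis by blast
        next
          case True
          obtain k where k: "\<And>i. k $ i \<in> \<int>" "y - k \<in> torus_points" by (rule torus_representative[of y]) blast
          then have "V (y - k) = 0" using True periodic_minus[OF V(2)] by metis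
          then obtain i where i: "i \<in> {1..m}" "y - k = x i" using assms(5) k(2) by blast
          have "i \<noteq> j"
          proof
            assume "i = j"
            then have "y = x j + k" using i by (simp add: algebra_simps)
            moreover have "\<delta> \<le> dist y (x j + k)" using y k(1) by (auto simp: K_def)
            ultimately show False using delta(1) by simp
          qed
          then have "k0 < trace (matrix_sqrt ((1/2) *\<^sub>R hessian V (x i)))"
            using k0(2) i by (simp add: kappa_def)
          moreover have "0 < k0" using k0(1) assms(9) by linarith
          ultimately obtain d where d: "d > 0" "eventually (\<lambda>\<epsilon>. \<forall>q\<in>ball (x i) d.
              exp (- w \<epsilon> q / \<epsilon>) \<le> 2 * exp (- (c \<epsilon> + \<epsilon> powr \<beta>) / \<epsilon>)) (at_right 0)"
            using high_energy_well_bound[OF energy zero(1) root] i(1) by blast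
          from d(2) eventually_eps have "eventually (\<lambda>\<epsilon>. \<forall>q\<in>ball y d. exp (- w \<epsilon> q / \<epsilon>) \<le> 2 * exp (- (c \<epsilon> + \<epsilon> powr \<beta>) / \<epsilon>)) (at_right 0)"
          proof eventually_elim
            case (elim \<epsilon>)
            show ?case
            proof
              fix q assume "q \<in> ball y d"
              then have "q - k \<in> ball (x i) d" by (simp add: i(2)[symmetric] dist_norm)
              moreover have "w \<epsilon> (q - k) = w \<epsilon> q"
                using periodic_minus[OF classical_solutionD(2)[OF sol]] k(1) elim by blast
              ultimately show "exp (- w \<epsilon> q / \<epsilon>) \<le> 2 * exp (- (c \<epsilon> + \<epsilon> powr \<beta>) / \<epsilon>)"
                using elim(1) by metis
            qed
          qed
          with d(1) show ?thesis by blast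
        qed
      qed
      moreover have "eventually (\<lambda>\<epsilon>. 2 * B * s \<epsilon> < e / 2) (at_right 0)"
        using tendsto_mult_left[OF s_lim, of "2 * B"] e by (intro order_tendstoD) auto
      ultimately show "eventually (\<lambda>\<epsilon>. dist (LINT y|density torus_measure (\<lambda>y. ennreal (gibbs_density \<epsilon> (w \<epsilon>) y)). \<phi> y)
          (\<phi> (x j)) < e) (at_right 0)"
        using eventually_eps
      proof eventually_elim
        case (elim \<epsilon>)
        then have eps: "0 < \<epsilon>" "\<epsilon> < 1" by auto
        define Z where "Z = (LINT y|torus_measure. exp (- w \<epsilon> y / \<epsilon>))"
        define Z0 where "Z0 = exp (- c \<epsilon> / \<epsilon> - 1) * (\<epsilon> powr (1 + \<alpha>) / (L * n)) ^ n"
        have Ln: "L * real n > 0" using L(1) by (simp add: n_def)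
        have Z0: "0 < Z0" using eps Ln by (simp add: Z0_def)
        have "Z0 \<le> Z"
          unfolding Z0_def Z_def c_def n_def
          using partition_function_lower_bound[OF sol[OF eps] eps assms(7) L] p[OF eps] by blast
        then have Z: "0 < Z" using Z0 by linarith
        have s_eq: "2 * exp (- (c \<epsilon> + \<epsilon> powr \<beta>) / \<epsilon>) / Z0 = s \<epsilon>"
        proof -
          have "(\<epsilon> powr (1 + \<alpha>) / (L * n)) ^ n = \<epsilon> powr ((1 + \<alpha>) * real n) / (L * n) ^ n"
            using eps by (simp add: power_divide powr_powr[symmetric] powr_realpow)
          moreover have "exp (- (c \<epsilon> + \<epsilon> powr \<beta>) / \<epsilon>) = exp (- c \<epsilon> / \<epsilon> - 1) * (exp 1 * exp (- (\<epsilon> powr (\<beta> - 1))))"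
            using eps by (simp add: exp_add[symmetric] powr_diff add_divide_distrib diff_divide_distrib)
          ultimately show ?thesis using eps Ln by (simp add: Z0_def s_def)
        qed
        have s0: "0 \<le> s \<epsilon>" using Z0 unfolding s_eq[symmetric] by simp
        have "\<bar>(LINT y|density torus_measure (\<lambda>y. ennreal (gibbs_density \<epsilon> (w \<epsilon>) y)). \<phi> y) - \<phi> (x j)\<bar> \<le> e / 2 + 2 * B * s \<epsilon>"
        proof (rule gibbs_average_deviation)
          show "continuous_on UNIV (w \<epsilon>)" by (intro C2_continuous classical_solutionD(1)[OF sol] eps)
          show "0 < (LINT y|torus_measure. exp (- w \<epsilon> y / \<epsilon>))" using Z by (simp add: Z_def)
          show "0 \<le> e / 2" "0 \<le> 2 * B * s \<epsilon>" using e B(1) s0 by auto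
          fix y :: "real ^ 'n" assume y: "y \<in> torus_points"
          let ?g = "gibbs_density \<epsilon> (w \<epsilon>) y"
          have g0: "0 \<le> ?g" using Z by (simp add: gibbs_density_def Z_def)
          show "?g * \<bar>\<phi> y - \<phi> (x j)\<bar> \<le> e / 2 * ?g + 2 * B * s \<epsilon>"
          proof (cases "y \<in> K")
            case True
            have "?g \<le> 2 * exp (- (c \<epsilon> + \<epsilon> powr \<beta>) / \<epsilon>) / Z0"
              unfolding gibbs_density_def Z_def[symmetric]
              using elim(1) True Z0 \<open>Z0 \<le> Z\<close> by (intro frac_le) auto
            then have "?g \<le> s \<epsilon>" by (simp only: s_eq)
            moreover have "\<bar>\<phi> y - \<phi> (x j)\<bar> \<le> 2 * B" using B(2)[of y] B(2)[of "x j"] by linarith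
            ultimately have "?g * \<bar>\<phi> y - \<phi> (x j)\<bar> \<le> s \<epsilon> * (2 * B)" using s0 by (intro mult_mono) auto
            moreover have "0 \<le> e / 2 * ?g" using e g0 by simp
            ultimately show ?thesis by (simp add: mult_ac)
          next
            case False
            then obtain k where k: "\<And>i. k $ i \<in> \<int>" "dist y (x j + k) < \<delta>"
              using y torus_points_subset_cbox by (force simp: K_def not_le)
            have "dist (y - k) (x j) < \<delta>" using k(2) by (simp add: dist_norm algebra_simps)
            then have "\<bar>\<phi> y - \<phi> (x j)\<bar> < e / 2"
              using delta(2)[of "y - k"] periodic_minus[OF phi(2) k(1)] by simp
            then have "?g * \<bar>\<phi> y - \<phi> (x j)\<bar> \<le> ?g * (e / 2)" using g0 by (intro mult_left_mono) auto
            moreover have "0 \<le> 2 * B * s \<epsilon>" using B(1) s0 by simp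
            ultimately show ?thesis by (simp add: mult_ac)
          qed
        qed (use phi eps in auto)
        then show ?case using elim(2) by (simp add: dist_real_def)
      qed
    qed
    ultimately show "((\<lambda>\<epsilon>. LINT y|density torus_measure (\<lambda>y. ennreal (gibbs_density \<epsilon> (w \<epsilon>) y)). \<phi> y)
        \<longlongrightarrow> (LINT y|return torus_measure (x j). \<phi> y)) (at_right 0)" by simp
  qed
qed

end
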